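(* Fix $x\in[0,1]$ and let the model assumptions (A) described in the context hold. Let $h^{\ast}=N^{-\frac{1}{\mathfrak a\beta+1}}$ and let $\hat f=\hat f_{h^{\ast}}$ be the local polynomial quasi-maximum likelihood estimator with bandwidth $h^\ast$ defined in the context. Then, as $N\to\infty$, $$\big|\hat f(x)-f(x)\big|=\mathcal O_{\mathbb P_f}\Big(N^{-\frac{\beta}{\mathfrak a\beta+1}}\Big).$$
   Context: **Hölder class.** For $\beta>0$ put $\langle\beta\rangle=\max\{m\in\mathbb N_0: m<\beta\}$. $f\in\mathcal H(L,\beta)$ means that $f$ is $\langle\beta\rangle$ times differentiable and $|f^{(\langle\beta\rangle)}(y)-f^{(\langle\beta\rangle)}(z)|\le L|y-z|^{\beta-\langle\beta\rangle}$ for all $y,z$ in the domain of the function ($[0,1]$ for the coefficient function $f$; $[0,\infty)$ for $F_\varepsilon$ below). **Model assumptions (A).** Fix $L,\beta>0$, $\rho\in(0,1)$, $\mathfrak a,\mathfrak c,\mathfrak c_g,\delta\in(0,\infty)$, $L_\varepsilon,\beta_\varepsilon>0$. The coefficient function $f:[0,1]\to[0,\rho]$ lies in $\mathcal H(L,\beta)$ and is extended to $\mathbb R$ by $f(u)=f(0)$ for $u<0$ and $f(u)=f(1)$ for $u>1$. The innovations $(\varepsilon_k)_{k\in\mathbb Z}$ are i.i.d. with distribution function $F_\varepsilon$ such that (i) as $y\downarrow0$, $F_\varepsilon(y)=\mathfrak c\,y^{\mathfrak a}+g(y)$ with $|g(y)|\le\mathfrak c_g\,y^{\mathfrak a+\delta}$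 (so $\varepsilon_k\ge0$ a.s.), and $F_\varepsilon\in\mathcal H(L_\varepsilon,\beta_\varepsilon)$; (ii) $\mathbb E\varepsilon_1^p<\infty$ for $p=\max\{1,2\mathfrak a+\delta\}$. For $N\in\mathbb N$ the process satisfies $X_k=f(k/N)X_{k-1}+\varepsilon_k$ and is defined for all $k\in\mathbb Z$ by $X_k=\sum_{i\ge0}\big(\prod_{l=0}^{i-1}f(\tfrac{k-l}{N})\big)\varepsilon_{k-i}$. $\mathbb P_f$ denotes probability under coefficient function $f$. **Estimator.** Let $Y_k=X_k/X_{k-1}$ and $h>0$. Consider polynomials $p(y)=\sum_{0\le i\le\beta+1}b_i(y-x)^i$ (sum over integers $i$). The coefficient vector $(\hat b_i)$ is a maximiser of $\sum_{k:|k/N-x|\le h}p(k/N)$ over all $(b_i)$, subject to the constraints $p(k/N)\le Y_k$ for all $k\in\{1,\dots,N\}$ with $|k/N-x|\le h$. Then $\hat f_h(x):=\hat b_0$. *)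

theory Defs
  imports "HOL-Probability.Probability"
begin

definition hoelder_order :: "real \<Rightarrow> nat" where
  "hoelder_order \<beta> = Max {m :: nat. real m < \<beta>}"

text \<open>Derivatives are taken within the domain S, hence one-sided at an endpoint of S.\<close>

definition hoelder_class :: "real set \<Rightarrow> real \<Rightarrow> real \<Rightarrow> (real \<Rightarrow> real) set" where
  "hoelder_class S L \<beta> = {f. \<exists>D :: nat \<Rightarrow> real \<Rightarrow> real.
     (\<forall>y\<in>S. D 0 y = f y) \<and>
     (\<forall>m < hoelder_order \<beta>. \<forall>y\<in>S. (D m has_real_derivative D (Suc m) y) (at y within S)) \<and>
     (\<forall>y\<in>S. \<forall>z\<in>S. \<bar>D (hoelder_order \<beta>) y - D (hoelder_order \<beta>) z\<bar>
        \<le> L * \<bar>y - z\<bar> powr (\<beta> - real (hoelder_order \<beta>)))}"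

definition const_extend :: "(real \<Rightarrow> real) \<Rightarrow> real \<Rightarrow> real" where
  "const_extend f u = (if u < 0 then f 0 else if u > 1 then f 1 else f u)"

text \<open>The series converges only almost surely; elsewhere suminf takes an arbitrary value.\<close>

definition ar_process ::
  "(real \<Rightarrow> real) \<Rightarrow> (int \<Rightarrow> 'w \<Rightarrow> real) \<Rightarrow> nat \<Rightarrow> int \<Rightarrow> 'w \<Rightarrow> real" where
  "ar_process f eps N k \<omega> =
     (\<Sum>i. (\<Prod>l<i. const_extend f (real_of_int (k - int l) / real N)) * eps (k - int i) \<omega>)"

definition ar_ratio ::
  "(real \<Rightarrow> real) \<Rightarrow> (int \<Rightarrow> 'w \<Rightarrow> real) \<Rightarrow> nat \<Rightarrow> int \<Rightarrow> 'w \<Rightarrow> real" where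
  "ar_ratio f eps N k \<omega> = ar_process f eps N k \<omega> / ar_process f eps N (k - 1) \<omega>"

definition local_indices :: "nat \<Rightarrow> real \<Rightarrow> real \<Rightarrow> int set" where
  "local_indices N x h = {k. 1 \<le> k \<and> k \<le> int N \<and> \<bar>real_of_int k / real N - x\<bar> \<le> h}"

text \<open>A coefficient vector is a function on nat of which only the entries with index at most
  \<open>\<beta> + 1\<close> are used.\<close>

definition local_poly :: "real \<Rightarrow> real \<Rightarrow> (nat \<Rightarrow> real) \<Rightarrow> real \<Rightarrow> real" where
  "local_poly \<beta> x b y = (\<Sum>i\<in>{i :: nat. real i \<le> \<beta> + 1}. b i * (y - x) ^ i)"

definition lp_feasible ::
  "real \<Rightarrow> real \<Rightarrow> real \<Rightarrow> nat \<Rightarrow> (int \<Rightarrow> real) \<Rightarrow> (nat \<Rightarrow> real) \<Rightarrow> bool" where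
  "lp_feasible \<beta> x h N Y b \<longleftrightarrow>
     (\<forall>k\<in>local_indices N x h. local_poly \<beta> x b (real_of_int k / real N) \<le> Y k)"

definition lp_objective :: "real \<Rightarrow> real \<Rightarrow> real \<Rightarrow> nat \<Rightarrow> (nat \<Rightarrow> real) \<Rightarrow> real" where
  "lp_objective \<beta> x h N b =
     (\<Sum>k\<in>local_indices N x h. local_poly \<beta> x b (real_of_int k / real N))"

definition is_quasi_mle ::
  "real \<Rightarrow> real \<Rightarrow> real \<Rightarrow> nat \<Rightarrow> (int \<Rightarrow> real) \<Rightarrow> (nat \<Rightarrow> real) \<Rightarrow> bool" where
  "is_quasi_mle \<beta> x h N Y b \<longleftrightarrow>
     lp_feasible \<beta> x h N Y b \<and>
     (\<forall>b'. lp_feasible \<beta> x h N Y b' \<longrightarrow> lp_objective \<beta> x h N b' \<le> lp_objective \<beta> x h N b)"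

text \<open>Meant for measurable Z N: measure gives non-measurable sets the value 0.\<close>

definition bigo_in_prob :: "'w measure \<Rightarrow> (nat \<Rightarrow> 'w \<Rightarrow> real) \<Rightarrow> (nat \<Rightarrow> real) \<Rightarrow> bool" where
  "bigo_in_prob M Z r \<longleftrightarrow>
     (\<forall>\<eta>>0. \<exists>C>0. \<forall>\<^sub>F N in sequentially.
        measure M {\<omega> \<in> space M. \<bar>Z N \<omega>\<bar> > C * r N} \<le> \<eta>)"

end

theory Submission
  imports Defs
begin

text \<open>Write \<open>h = N powr (- 1 / (a \<beta> + 1))\<close>, so that \<open>N h (h\<^sup>\<beta>)\<^sup>a = 1\<close>.
  Since \<open>Y\<^sub>k = f (k/N) + \<epsilon>\<^sub>k / X\<^sub>k\<^sub>-\<^sub>1\<close>, the Taylor polynomial of \<open>f\<close> at \<open>x\<close> lowered by \<open>L h\<^sup>\<beta>\<close> is feasible.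
  Hence the difference \<open>q\<close> of the estimated polynomial and this one has nonnegative sum over the
  design points, and \<open>q\<close> is \<open>O(h\<^sup>\<beta>)\<close> from above wherever \<open>\<epsilon>\<^sub>k / X\<^sub>k\<^sub>-\<^sub>1\<close> is. If such points occur in each of a fixed
  large number of blocks of the window, then, coefficient vectors of bounded degree being
  controlled by any well-spread values, \<open>q\<close> is \<open>O(h\<^sup>\<beta>)\<close> everywhere on the window, in particular at \<open>x\<close>.
  As \<open>X\<^sub>k\<^sub>-\<^sub>1 \<ge> \<epsilon>\<^sub>k\<^sub>-\<^sub>1\<close>, it suffices to find in each block a pair with \<open>\<epsilon>\<^sub>k\<^sub>-\<^sub>1 > \<kappa>\<close> and \<open>\<epsilon>\<^sub>k \<le> z h\<^sup>\<beta>\<close>. A block contains of order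
  \<open>N h\<close> disjoint pairs, each successful with probability of order \<open>z\<^sup>a h powr (a \<beta>)\<close>, so that all
  of them fail with probability at most \<open>exp (- const z\<^sup>a)\<close>.\<close>

subsection \<open>Polynomials on a grid\<close>

text \<open>Induction on the degree: dividing \<open>p\<close> by the linear factor at the last node
  \<open>a\<close> leaves a quotient \<open>r\<close> of degree at most \<open>d\<close>. At the
  other nodes its values are \<open>(poly p (t j) - poly p a) / (t j - a)\<close>, hence controlled
  by separation, and the coefficients of \<open>p\<close> are recovered from those of
  \<open>r\<close> and from \<open>poly p a\<close>. The constant depends on \<open>d\<close> and
  \<open>s\<close> alone, so it serves all node tuples at once.\<close>

lemma sum_abs_coeff_le_separated_values:
  fixes s :: real
  assumes s: "s > 0"
  shows "\<exists>C>0. \<forall>p t. degree p \<le> d \<longrightarrow> (\<forall>j\<le>d. \<bar>t j\<bar> \<le> 1) \<longrightarrow>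
           (\<forall>i j. i < j \<longrightarrow> j \<le> d \<longrightarrow> s \<le> \<bar>t i - t j\<bar>) \<longrightarrow>
           (\<Sum>i\<le>d. \<bar>coeff p i\<bar>) \<le> C * (\<Sum>j\<le>d. \<bar>poly p (t j :: real)\<bar>)"
proof (induction d)
  case 0
  have "\<bar>coeff p 0\<bar> \<le> \<bar>poly p (t 0 :: real)\<bar>" if "degree p \<le> 0" for p and t :: "nat \<Rightarrow> real"
    using that by (simp add: poly_altdef)
  then show ?case by (intro exI[of _ 1]) auto
next
  case (Suc d)
  then obtain C where C: "C > 0" and IH:
    "\<And>p t. \<lbrakk>degree p \<le> d; \<And>j. j \<le> d \<Longrightarrow> \<bar>t j\<bar> \<le> 1; \<And>i j. i < j \<Longrightarrow> j \<le> d \<Longrightarrow> s \<le> \<bar>t i - t j\<bar>\<rbrakk>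
       \<Longrightarrow> (\<Sum>i\<le>d. \<bar>coeff p i\<bar>) \<le> C * (\<Sum>j\<le>d. \<bar>poly p (t j :: real)\<bar>)"
    by blast
  \<comment> \<open>The 1 pays for the remainder \<open>poly p a\<close>. The factor 2 arises
    because every coefficient of \<open>r\<close> contributes to two coefficients of
    \<open>p\<close>. \<open>C / s\<close> comes from the induction hypothesis, and
    \<open>d + 2\<close> absorbs the \<open>d + 1\<close> occurrences of
    \<open>poly p a\<close>.\<close>
  define C' where "C' = 1 + 2 * C * real (d + 2) / s"
  have "(\<Sum>i\<le>Suc d. \<bar>coeff p i\<bar>) \<le> C' * (\<Sum>j\<le>Suc d. \<bar>poly p (t j)\<bar>)"
    if deg: "degree p \<le> Suc d" and t1: "\<And>j. j \<le> Suc d \<Longrightarrow> \<bar>t j\<bar> \<le> 1"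
      and sep: "\<And>i j. i < j \<Longrightarrow> j \<le> Suc d \<Longrightarrow> s \<le> \<bar>t i - t j\<bar>" for p and t :: "nat \<Rightarrow> real"
  proof -
    define a where "a = t (Suc d)"
    define r where "r = synthetic_div p a"
    define P where "P = (\<Sum>j\<le>d. \<bar>poly p (t j)\<bar>)"
    define R where "R = (\<Sum>i\<le>d. \<bar>coeff r i\<bar>)"
    have p: "p = [:-a, 1:] * r + [:poly p a:]"
      unfolding r_def by (rule synthetic_div_correct'[symmetric])
    have degr: "degree r \<le> d" using deg by (simp add: r_def degree_synthetic_div)
    have a1: "\<bar>a\<bar> \<le> 1" using t1[of "Suc d"] by (simp add: a_def)
    have val: "\<bar>poly r (t j)\<bar> \<le> (\<bar>poly p (t j)\<bar> + \<bar>poly p a\<bar>) / s" if "j \<le> d" for j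
    proof -
      have "poly p (t j) = (t j - a) * poly r (t j) + poly p a"
        by (subst p) (simp add: algebra_simps)
      then have "\<bar>t j - a\<bar> * \<bar>poly r (t j)\<bar> \<le> \<bar>poly p (t j)\<bar> + \<bar>poly p a\<bar>"
        by (simp flip: abs_mult)
      moreover have "s * \<bar>poly r (t j)\<bar> \<le> \<bar>t j - a\<bar> * \<bar>poly r (t j)\<bar>"
        using sep[of j "Suc d"] that by (intro mult_right_mono) (auto simp: a_def)
      ultimately show ?thesis using s by (simp add: field_simps)
    qed
    have "R \<le> C * (\<Sum>j\<le>d. \<bar>poly r (t j)\<bar>)"
      unfolding R_def using degr t1 sep by (intro IH) auto
    also have "\<dots> \<le> C * (\<Sum>j\<le>d. (\<bar>poly p (t j)\<bar> + \<bar>poly p a\<bar>) / s)"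
      using C val by (intro mult_left_mono sum_mono) auto
    also have "\<dots> = C * (P + real (d + 1) * \<bar>poly p a\<bar>) / s"
      by (simp add: P_def sum.distrib flip: sum_divide_distrib)
    finally have R: "R \<le> C * (P + real (d + 1) * \<bar>poly p a\<bar>) / s" .
    have c0: "\<bar>coeff p 0\<bar> \<le> \<bar>poly p a\<bar> + \<bar>coeff r 0\<bar>"
    proof -
      have "coeff p 0 = poly p a - a * coeff r 0" by (subst p) simp
      moreover have "\<bar>a * coeff r 0\<bar> \<le> \<bar>coeff r 0\<bar>"
        using a1 by (simp add: abs_mult mult_left_le_one_le)
      ultimately show ?thesis by linarith
    qed
    have cS: "\<bar>coeff p (Suc i)\<bar> \<le> \<bar>coeff r i\<bar> + \<bar>coeff r (Suc i)\<bar>" for i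
    proof -
      have "coeff p (Suc i) = coeff r i - a * coeff r (Suc i)"
        by (subst p) simp
      moreover have "\<bar>a * coeff r (Suc i)\<bar> \<le> \<bar>coeff r (Suc i)\<bar>"
        using a1 by (simp add: abs_mult mult_left_le_one_le)
      ultimately show ?thesis by linarith
    qed
    \<comment> \<open>The shifted sum gains the coefficient of index \<open>Suc d\<close>, which
      vanishes by the degree bound on \<open>r\<close>.\<close>
    have R': "\<bar>coeff r 0\<bar> + (\<Sum>i\<le>d. \<bar>coeff r (Suc i)\<bar>) = R"
      using degr coeff_eq_0[of r "Suc d"] sum.atMost_Suc_shift[of "\<lambda>i. \<bar>coeff r i\<bar>" d]
      by (simp add: R_def)
    have "(\<Sum>i\<le>Suc d. \<bar>coeff p i\<bar>) = \<bar>coeff p 0\<bar> + (\<Sum>i\<le>d. \<bar>coeff p (Suc i)\<bar>)"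
      by (rule sum.atMost_Suc_shift)
    also have "\<dots> \<le> \<bar>poly p a\<bar> + \<bar>coeff r 0\<bar> + (\<Sum>i\<le>d. \<bar>coeff r i\<bar> + \<bar>coeff r (Suc i)\<bar>)"
      by (intro add_mono c0 sum_mono cS)
    also have "\<dots> = \<bar>poly p a\<bar> + 2 * R"
      using R' by (simp add: sum.distrib R_def)
    also have "\<dots> \<le> \<bar>poly p a\<bar> + 2 * (C * (P + real (d + 1) * \<bar>poly p a\<bar>) / s)"
      using R by simp
    also have "\<dots> \<le> C' * (P + \<bar>poly p a\<bar>)"
    proof -
      have "P \<ge> 0" by (simp add: P_def sum_nonneg)
      then have "P + real (d + 1) * \<bar>poly p a\<bar> \<le> real (d + 2) * (P + \<bar>poly p a\<bar>)"
        by (simp add: algebra_simps)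
      then have "2 * (C * (P + real (d + 1) * \<bar>poly p a\<bar>) / s)
          \<le> 2 * (C * (real (d + 2) * (P + \<bar>poly p a\<bar>)) / s)"
        using C s by (intro mult_left_mono divide_right_mono) auto
      then show ?thesis using \<open>P \<ge> 0\<close> by (simp add: C'_def algebra_simps)
    qed
    finally show ?thesis by (simp add: P_def a_def)
  qed
  moreover have "C' > 0" using C s by (auto simp: C'_def intro!: add_pos_nonneg)
  ultimately show ?case by blast
qed

text \<open>With \<open>D = d + 1\<close> and \<open>m = n div D\<close>, the first
  \<open>D * m\<close> grid indices split into \<open>m\<close> tuples
  \<open>r, r + m, ..., r + d * m\<close>. Points of one tuple are at least \<open>m * s\<close>
  apart, which is bounded below by a constant, so the previous lemma applies to every tuple with the
  same constant. Summing over the tuples yields a bound of order \<open>n\<close>.\<close>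

lemma sum_abs_poly_grid_ge:
  "\<exists>C>0. \<forall>p \<alpha> s n. degree p \<le> d \<longrightarrow> (\<forall>i<n. \<bar>\<alpha> + real i * s\<bar> \<le> 1) \<longrightarrow> s > 0 \<longrightarrow>
     1/2 \<le> real n * s \<longrightarrow> d < n \<longrightarrow>
     C * real n * (\<Sum>i\<le>d. \<bar>coeff p i\<bar>) \<le> (\<Sum>i<n. \<bar>poly p (\<alpha> + real i * s)\<bar>)"
proof -
  define D where "D = d + 1"
  \<comment> \<open>From \<open>n \<le> 2 * D * m\<close> and \<open>n * s \<ge> 1/2\<close> follows
    \<open>m * s \<ge> 1 / (4 * D)\<close>.\<close>
  define s0 where "s0 = 1 / (4 * real D)"
  have "s0 > 0" by (simp add: s0_def D_def)
  from sum_abs_coeff_le_separated_values[OF this, of d] obtain C where C: "C > 0" and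
    bound: "\<And>p t. \<lbrakk>degree p \<le> d; \<And>j. j \<le> d \<Longrightarrow> \<bar>t j\<bar> \<le> 1; \<And>i j. i < j \<Longrightarrow> j \<le> d \<Longrightarrow> s0 \<le> \<bar>t i - t j\<bar>\<rbrakk>
       \<Longrightarrow> (\<Sum>i\<le>d. \<bar>coeff p i\<bar>) \<le> C * (\<Sum>j\<le>d. \<bar>poly p (t j :: real)\<bar>)"
    by blast
  have "1 / (2 * D * C) * real n * (\<Sum>i\<le>d. \<bar>coeff p i\<bar>) \<le> (\<Sum>i<n. \<bar>poly p (\<alpha> + real i * s)\<bar>)"
    if deg: "degree p \<le> d" and t1: "\<And>i. i < n \<Longrightarrow> \<bar>\<alpha> + real i * s\<bar> \<le> 1" and s: "s > 0"
      and ns: "1/2 \<le> real n * s" and n: "d < n" for p \<alpha> s n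
  proof -
    define K where "K = (\<Sum>i\<le>d. \<bar>coeff p i\<bar>)"
    define m where "m = n div D"
    define v where "v i = \<bar>poly p (\<alpha> + real i * s)\<bar>" for i :: nat
    have D: "D > 0" by (simp add: D_def)
    have m1: "m \<ge> 1" using n D by (simp add: m_def D_def Suc_leI div_greater_zero_iff)
    have "n < D * (m + 1)"
      using D unfolding m_def by (metis Suc_eq_plus1 dividend_less_times_div mult.commute mult_Suc_right add.commute)
    also have "\<dots> \<le> D * (2 * m)" using m1 by (intro mult_left_mono) auto
    finally have nm: "real n \<le> 2 * real D * real m"
      by (metis less_imp_le mult.assoc mult.commute of_nat_le_iff of_nat_mult of_nat_numeral)
    have mD: "m * D \<le> n" by (simp add: m_def)
    have idx: "r + j * m < m * D" if "r < m" "j \<le> d" for r j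
    proof -
      have "r + j * m < m + d * m" using that by (intro add_less_le_mono mult_right_mono) auto
      then show ?thesis by (simp add: D_def algebra_simps)
    qed
    have ms: "s0 \<le> real m * s"
    proof -
      have "1/2 \<le> 2 * real D * real m * s" using ns nm s
        by (meson mult_right_mono less_imp_le order_trans)
      then show ?thesis using D by (simp add: s0_def field_simps)
    qed
    have tuple: "K \<le> C * (\<Sum>j\<le>d. v (r + j * m))" if r: "r < m" for r
      unfolding K_def v_def
    proof (rule bound[OF deg])
      fix j assume "j \<le> d"
      with idx[OF r] mD show "\<bar>\<alpha> + real (r + j * m) * s\<bar> \<le> 1"
        by (intro t1) (meson less_le_trans)
    next
      fix i j :: nat assume ij: "i < j" "j \<le> d"
      have "real m * s * 1 \<le> real m * s * (real j - real i)"
        using ij s by (intro mult_left_mono) auto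
      moreover have "\<dots> = \<bar>\<alpha> + real (r + i * m) * s - (\<alpha> + real (r + j * m) * s)\<bar>"
      proof -
        have "\<alpha> + real (r + i * m) * s - (\<alpha> + real (r + j * m) * s)
            = - (real m * s * (real j - real i))"
          by (simp add: algebra_simps)
        moreover have "real m * s * (real j - real i) \<ge> 0" using ij s by simp
        ultimately show ?thesis by simp
      qed
      ultimately show "s0 \<le> \<bar>\<alpha> + real (r + i * m) * s - (\<alpha> + real (r + j * m) * s)\<bar>"
        using ms by linarith
    qed
    have "real m * K = (\<Sum>r<m. K)" by simp
    also have "\<dots> \<le> (\<Sum>r<m. C * (\<Sum>j\<le>d. v (r + j * m)))"
      using tuple by (intro sum_mono) auto
    also have "\<dots> = C * (\<Sum>j<D. \<Sum>r<m. v (r + j * m))"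
      by (subst sum.swap) (simp add: sum_distrib_left D_def lessThan_Suc_atMost)
    also have "(\<Sum>j<D. \<Sum>r<m. v (r + j * m)) = (\<Sum>i<D * m. v i)"
    proof -
      have "(\<Sum>r<m. v (r + j * m)) = sum v {j * m..<j * m + m}" for j
        using sum.shift_bounds_nat_ivl[of v 0 "j * m" m] by (simp add: lessThan_atLeast0 add.commute)
      then show ?thesis using sum.nat_group[of v m D] by simp
    qed
    also have "C * \<dots> \<le> C * (\<Sum>i<n. v i)"
      using mD C by (intro mult_left_mono sum_mono2) (auto simp: v_def mult.commute)
    finally have *: "real m * K \<le> C * (\<Sum>i<n. v i)" .
    have "real n * K \<le> 2 * real D * (real m * K)"
      using mult_right_mono[OF nm, of K] by (simp add: K_def sum_nonneg algebra_simps)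
    also have "\<dots> \<le> 2 * real D * (C * (\<Sum>i<n. v i))"
      using * by (intro mult_left_mono) auto
    finally show ?thesis using C D by (simp add: field_simps K_def v_def)
  qed
  moreover have "1 / (2 * D * C) > 0" using C by (simp add: D_def)
  ultimately show ?thesis by blast
qed

lemma poly_lipschitz_unit:
  fixes p :: "real poly"
  assumes deg: "degree p \<le> d" and y: "\<bar>y\<bar> \<le> 1" and z: "\<bar>z\<bar> \<le> 1"
  shows "\<bar>poly p y - poly p z\<bar> \<le> real d * (\<Sum>i\<le>d. \<bar>coeff p i\<bar>) * \<bar>y - z\<bar>"
proof -
  have pw: "\<bar>y ^ i - z ^ i\<bar> \<le> real i * \<bar>y - z\<bar>" for i
    using norm_power_diff[of y z i] y z by simp
  have "poly p w = (\<Sum>i\<le>d. coeff p i * w ^ i)" for w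
    using deg by (simp add: poly_altdef) (rule sum.mono_neutral_left, auto simp: coeff_eq_0)
  then have "poly p y - poly p z = (\<Sum>i\<le>d. coeff p i * (y ^ i - z ^ i))"
    by (simp add: sum_subtractf algebra_simps)
  also have "\<bar>\<dots>\<bar> \<le> (\<Sum>i\<le>d. \<bar>coeff p i\<bar> * (real d * \<bar>y - z\<bar>))"
  proof (rule order.trans[OF sum_abs sum_mono])
    fix i assume "i \<in> {..d}"
    then have "real i * \<bar>y - z\<bar> \<le> real d * \<bar>y - z\<bar>" by (intro mult_right_mono) auto
    then have "\<bar>y ^ i - z ^ i\<bar> \<le> real d * \<bar>y - z\<bar>" using pw[of i] by linarith
    then show "\<bar>coeff p i * (y ^ i - z ^ i)\<bar> \<le> \<bar>coeff p i\<bar> * (real d * \<bar>y - z\<bar>)"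
      unfolding abs_mult by (intro mult_left_mono) auto
  qed
  also have "\<dots> = real d * (\<Sum>i\<le>d. \<bar>coeff p i\<bar>) * \<bar>y - z\<bar>"
    by (simp add: sum_distrib_left sum_distrib_right algebra_simps)
  finally show ?thesis .
qed

text \<open>A nonnegative sum turns the upper bounds into an \<open>L\<^sup>1\<close> bound, because the negative part of the
  polynomial cannot outweigh its positive part.\<close>

lemma poly_bound_one_sided_grid:
  "\<exists>C>0. \<exists>\<theta>>0. \<forall>p \<alpha> s n u. degree p \<le> d \<longrightarrow> (\<forall>i<n. \<bar>\<alpha> + real i * s\<bar> \<le> 1) \<longrightarrow> s > 0 \<longrightarrow>
     1/2 \<le> real n * s \<longrightarrow> d < n \<longrightarrow> u \<ge> 0 \<longrightarrow> 0 \<le> (\<Sum>i<n. poly p (\<alpha> + real i * s)) \<longrightarrow>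
     (\<forall>i<n. \<exists>j<n. \<bar>real i - real j\<bar> * s \<le> \<theta> \<and> poly p (\<alpha> + real j * s) \<le> u) \<longrightarrow>
     \<bar>coeff p 0\<bar> \<le> C * u"
proof -
  from sum_abs_poly_grid_ge[of d] obtain C where C: "C > 0" and
    grid: "\<And>p \<alpha> s n. \<lbrakk>degree p \<le> d; \<And>i. i < n \<Longrightarrow> \<bar>\<alpha> + real i * s\<bar> \<le> 1; s > 0; 1/2 \<le> real n * s; d < n\<rbrakk>
       \<Longrightarrow> C * real n * (\<Sum>i\<le>d. \<bar>coeff p i\<bar>) \<le> (\<Sum>i<n. \<bar>poly p (\<alpha> + real i * s)\<bar>)"
    by blast
  \<comment> \<open>Moving to a nearby good point costs at most \<open>d * K * \<theta>\<close>,
    with \<open>K\<close> the sum of absolute coefficients. This choice makes twice that cost at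
    most \<open>C * K / 2\<close>, which the lower bound \<open>C * K\<close> absorbs.\<close>
  define \<theta> where "\<theta> = C / (4 * (real d + 1))"
  have \<theta>: "\<theta> > 0" using C by (simp add: \<theta>_def)
  have "\<bar>coeff p 0\<bar> \<le> 4 / C * u"
    if deg: "degree p \<le> d" and t1: "\<And>i. i < n \<Longrightarrow> \<bar>\<alpha> + real i * s\<bar> \<le> 1" and s: "s > 0"
      and ns: "1/2 \<le> real n * s" and n: "d < n" and u: "u \<ge> 0"
      and sum0: "0 \<le> (\<Sum>i<n. poly p (\<alpha> + real i * s))"
      and near: "\<And>i. i < n \<Longrightarrow> \<exists>j<n. \<bar>real i - real j\<bar> * s \<le> \<theta> \<and> poly p (\<alpha> + real j * s) \<le> u"
    for p \<alpha> s n u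
  proof -
    define K where "K = (\<Sum>i\<le>d. \<bar>coeff p i\<bar>)"
    define v where "v i = poly p (\<alpha> + real i * s)" for i :: nat
    define w where "w = u + real d * K * \<theta>"
    have K0: "K \<ge> 0" by (simp add: K_def sum_nonneg)
    have w0: "w \<ge> 0" using u K0 \<theta> by (simp add: w_def)
    have vw: "v i \<le> w" if i: "i < n" for i
    proof -
      from near[OF i] obtain j where j: "j < n" "\<bar>real i - real j\<bar> * s \<le> \<theta>" "v j \<le> u"
        by (auto simp: v_def)
      have "\<bar>v i - v j\<bar> \<le> real d * K * \<bar>(\<alpha> + real i * s) - (\<alpha> + real j * s)\<bar>"
        unfolding v_def K_def using deg t1 i j by (intro poly_lipschitz_unit) auto
      also have "\<bar>(\<alpha> + real i * s) - (\<alpha> + real j * s)\<bar> = \<bar>real i - real j\<bar> * s"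
        using s by (simp add: left_diff_distrib[symmetric] abs_mult)
      also have "real d * K * \<dots> \<le> real d * K * \<theta>"
        using j K0 by (intro mult_left_mono) auto
      finally show ?thesis using j by (simp add: w_def)
    qed
    have "C * real n * K \<le> (\<Sum>i<n. \<bar>v i\<bar>)"
      unfolding K_def v_def by (rule grid[OF deg t1 s ns n])
    also have "\<dots> \<le> (\<Sum>i<n. 2 * w - v i)"
    proof (intro sum_mono)
      fix i assume "i \<in> {..<n}"
      then show "\<bar>v i\<bar> \<le> 2 * w - v i" using vw[of i] w0 by auto
    qed
    also have "\<dots> \<le> real n * (2 * w)" using sum0 by (simp add: sum_subtractf v_def)
    finally have "real n * (C * K) \<le> real n * (2 * w)" by (simp add: mult_ac)
    then have "C * K \<le> 2 * w" using n by simp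
    also have "2 * w = 2 * u + C * K * (real d / (2 * (real d + 1)))"
      by (simp add: w_def \<theta>_def field_simps)
    also have "\<dots> \<le> 2 * u + C * K * (1/2)"
      using C K0 by (intro add_mono mult_left_mono) (auto simp: field_simps)
    finally have "K \<le> 4 / C * u" using C by (simp add: field_simps)
    moreover have "\<bar>coeff p 0\<bar> \<le> K"
      unfolding K_def by (rule member_le_sum) auto
    ultimately show ?thesis by linarith
  qed
  moreover have "4 / C > 0" using C by simp
  ultimately show ?thesis using \<theta> by blast
qed

subsection \<open>The deterministic error bound\<close>

lemma hoelder_order_bounds:
  assumes "\<beta> > 0"
  shows "real (hoelder_order \<beta>) < \<beta>" "\<beta> \<le> real (hoelder_order \<beta>) + 1"
proof -
  have fin: "finite {m :: nat. real m < \<beta>}"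
    by (rule finite_subset[of _ "{..nat \<lceil>\<beta>\<rceil>}"]) (auto, linarith)
  have "hoelder_order \<beta> \<in> {m :: nat. real m < \<beta>}"
    unfolding hoelder_order_def using fin assms by (intro Max_in) (auto intro: exI[of _ 0])
  then show "real (hoelder_order \<beta>) < \<beta>" by simp
  have "Suc (hoelder_order \<beta>) \<notin> {m :: nat. real m < \<beta>}"
    using Max_ge[OF fin, of "Suc (hoelder_order \<beta>)"] by (auto simp: hoelder_order_def)
  then show "\<beta> \<le> real (hoelder_order \<beta>) + 1" by simp
qed

text \<open>The derivative of order \<open>l\<close> is only Hoelder, so there is no next derivative
  to bound a remainder. Subtracting the top Taylor term beforehand gives a function
  \<open>G 0\<close> whose derivative of order \<open>l\<close> is \<open>D l z - D l x\<close>. The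
  Hoelder condition bounds it, and Taylor's theorem with remainder of order \<open>l\<close> then
  supplies the missing power of \<open>\<bar>y - x\<bar>\<close>.\<close>

lemma hoelder_class_taylor:
  assumes \<beta>: "\<beta> > 0" and f: "f \<in> hoelder_class {0..1} L \<beta>" and L: "L \<ge> 0" and x: "x \<in> {0..1}"
  obtains b :: "nat \<Rightarrow> real" where "b 0 = f x"
    "\<And>y. y \<in> {0..1} \<Longrightarrow>
       \<bar>f y - (\<Sum>i\<le>hoelder_order \<beta>. b i * (y - x) ^ i)\<bar> \<le> L * \<bar>y - x\<bar> powr \<beta>"
proof -
  define l where "l = hoelder_order \<beta>"
  note l = hoelder_order_bounds[OF \<beta>, folded l_def]
  from f obtain D where D0: "\<And>y. y \<in> {0..1} \<Longrightarrow> D 0 y = f y"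
    and D: "\<And>m y. m < l \<Longrightarrow> y \<in> {0..1} \<Longrightarrow>
        (D m has_real_derivative D (Suc m) y) (at y within {0..1})"
    and Dl: "\<And>y z. y \<in> {0..1} \<Longrightarrow> z \<in> {0..1} \<Longrightarrow> \<bar>D l y - D l z\<bar> \<le> L * \<bar>y - z\<bar> powr (\<beta> - real l)"
    unfolding hoelder_class_def l_def[symmetric] by blast
  define b where "b i = D i x / fact i" for i
  have "\<bar>f y - (\<Sum>i\<le>l. b i * (y - x) ^ i)\<bar> \<le> L * \<bar>y - x\<bar> powr \<beta>" if y: "y \<in> {0..1}" for y
  proof (cases "l = 0")
    case True
    then show ?thesis using Dl[OF y x] D0[OF x] D0[OF y] by (simp add: b_def)
  next
    case False
    then obtain n where n: "l = Suc n" by (cases l) auto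
    \<comment> \<open>Working on the segment from \<open>x\<close> to \<open>y\<close> instead of
      the unit interval makes the derivative bound \<open>B\<close> scale with
      \<open>\<bar>y - x\<bar>\<close>.\<close>
    define S where "S = closed_segment x y"
    have S: "S \<subseteq> {0..1}" using x y unfolding S_def
      by (intro closed_segment_subset) auto
    define G where "G m z = D m z - D l x * (z - x) ^ (l - m) / fact (l - m)" for m z
    define B where "B = L * \<bar>y - x\<bar> powr (\<beta> - real l)"
    have "norm (G 0 y - (\<Sum>i\<le>n. G i x * (y - x) ^ i / fact i)) \<le> B * norm (y - x) ^ Suc n / fact n"
    proof (rule field_Taylor[where S = S])
      show "convex S" "x \<in> S" "y \<in> S" by (auto simp: S_def)
    next
      fix m z assume z: "z \<in> S" and m: "m \<le> n"
      have lm: "l - m = Suc (n - m)" "l - Suc m = n - m" using m n by auto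
      have "(D m has_real_derivative D (Suc m) z) (at z within S)"
        using D[of m z] z m n S by (intro DERIV_subset[OF D]) auto
      moreover have "((\<lambda>z. (z - x) ^ Suc k / fact (Suc k)) has_real_derivative (z - x) ^ k / fact k)
          (at z within S)" for k
      proof -
        have "((\<lambda>z. (z - x) ^ Suc k / fact (Suc k)) has_real_derivative
            real (Suc k) * (z - x) ^ k / fact (Suc k)) (at z within S)"
          by (intro DERIV_cdivide) (rule derivative_eq_intros refl | simp)+
        then show ?thesis by (simp del: of_nat_Suc)
      qed
      ultimately show "(G m has_real_derivative G (Suc m) z) (at z within S)"
        unfolding G_def lm times_divide_eq_right[symmetric]
        by (intro DERIV_diff DERIV_cmult)
    next
      fix z assume z: "z \<in> S"
      have "\<bar>D l z - D l x\<bar> \<le> L * \<bar>z - x\<bar> powr (\<beta> - real l)" using z S x by (intro Dl) auto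
      also have "\<dots> \<le> B"
      proof -
        have "\<bar>z - x\<bar> \<le> \<bar>y - x\<bar>"
          using z unfolding S_def by (auto simp: closed_segment_eq_real_ivl split: if_splits)
        then show ?thesis unfolding B_def using L l by (intro mult_left_mono powr_mono2) auto
      qed
      finally show "norm (G (Suc n) z) \<le> B" by (simp add: G_def n)
    qed
    also have "\<dots> \<le> B * norm (y - x) ^ Suc n"
    proof -
      have "B * norm (y - x) ^ Suc n \<ge> 0" using L by (simp add: B_def)
      moreover have "1 \<le> (fact n :: real)" by (rule fact_ge_1)
      ultimately show ?thesis by (simp add: divide_le_eq mult_le_cancel_left1)
    qed
    also have "\<dots> = L * \<bar>y - x\<bar> powr \<beta>"
    proof (cases "y = x")
      case False
      then have "\<bar>y - x\<bar> ^ l = \<bar>y - x\<bar> powr real l" by (simp add: powr_realpow)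
      then show ?thesis using False by (simp add: B_def n flip: powr_add)
    qed (use \<beta> in \<open>simp add: B_def\<close>)
    also have "G 0 y - (\<Sum>i\<le>n. G i x * (y - x) ^ i / fact i) = f y - (\<Sum>i\<le>l. b i * (y - x) ^ i)"
    proof -
      \<comment> \<open>The subtracted term contains a positive power of \<open>z - x\<close> at
        these orders and so vanishes at \<open>x\<close>.\<close>
      have "G i x = D i x" if "i \<le> n" for i
        using that by (simp add: G_def n power_0_left)
      then have "(\<Sum>i\<le>n. G i x * (y - x) ^ i / fact i) = (\<Sum>i\<le>n. b i * (y - x) ^ i)"
        by (intro sum.cong) (auto simp: b_def)
      then show ?thesis using D0[OF y] by (simp add: G_def b_def n)
    qed
    finally show ?thesis by simp
  qed
  moreover have "b 0 = f x" using D0[OF x] by (simp add: b_def)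
  ultimately show ?thesis using that unfolding l_def by blast
qed

section \<open>The design window and the comparison with the Taylor polynomial\<close>

lemma local_poly_eq:
  assumes "\<beta> > 0"
  shows "local_poly \<beta> x b y = (\<Sum>i\<le>nat \<lfloor>\<beta> + 1\<rfloor>. b i * (y - x) ^ i)"
proof -
  have "real i \<le> \<beta> + 1 \<longleftrightarrow> i \<le> nat \<lfloor>\<beta> + 1\<rfloor>" for i
    using assms by linarith
  then have "{i :: nat. real i \<le> \<beta> + 1} = {..nat \<lfloor>\<beta> + 1\<rfloor>}" by auto
  then show ?thesis by (simp add: local_poly_def)
qed

text \<open>Near an end of the unit interval one half of the window may be cut off, so the lower
  bound on its size is \<open>N * h\<close> and not \<open>2 * N * h\<close>. The terms
  \<open>- 2\<close> and \<open>+ 1\<close> cover rounding.\<close>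

lemma local_indices_interval:
  assumes x: "0 \<le> x" "x \<le> 1" and N: "N \<ge> 1" and h: "0 < h" "h \<le> 1"
  obtains lo n where "local_indices N x h = (\<lambda>i. lo + int i) ` {..<n}"
    "real N * h - 2 \<le> real n" "real n \<le> 2 * real N * h + 1"
proof -
  define lo where "lo = max 1 \<lceil>real N * (x - h)\<rceil>"
  define hi where "hi = min (int N) \<lfloor>real N * (x + h)\<rfloor>"
  have N': "real N > 0" using N by simp
  have mem: "k \<in> local_indices N x h \<longleftrightarrow> lo \<le> k \<and> k \<le> hi" for k
  proof -
    have "\<bar>real_of_int k / real N - x\<bar> \<le> h \<longleftrightarrow>
        real N * (x - h) \<le> real_of_int k \<and> real_of_int k \<le> real N * (x + h)"
      using N' by (simp add: abs_le_iff field_simps) auto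
    then show ?thesis
      by (auto simp: local_indices_def lo_def hi_def ceiling_le_iff le_floor_iff)
  qed
  define n where "n = nat (hi - lo + 1)"
  have "local_indices N x h = (\<lambda>i. lo + int i) ` {..<n}"
  proof (intro set_eqI iffI)
    fix k assume "k \<in> local_indices N x h"
    then show "k \<in> (\<lambda>i. lo + int i) ` {..<n}"
      by (intro image_eqI[of _ _ "nat (k - lo)"]) (auto simp: mem n_def)
  qed (auto simp: mem n_def)
  moreover have Nx: "0 \<le> real N * x" "real N * x \<le> real N" "0 \<le> real N * h" "real N * h \<le> real N"
    using x h N' by (auto simp: mult_left_le)
  have "real N * h - 2 \<le> real_of_int (hi - lo + 1)"
  proof -
    have "real_of_int lo \<le> max 1 (real N * (x - h) + 1)" unfolding lo_def by linarith
    moreover have "min (real N) (real N * (x + h) - 1) \<le> real_of_int hi" unfolding hi_def by linarith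
    ultimately show ?thesis using Nx by (auto simp: algebra_simps max_def min_def split: if_splits)
  qed
  then have "real N * h - 2 \<le> real n" unfolding n_def by linarith
  moreover have "real n \<le> 2 * real N * h + 1"
  proof -
    have "real N * (x - h) \<le> real_of_int lo" unfolding lo_def by linarith
    moreover have "real_of_int hi \<le> real N * (x + h)" unfolding hi_def by linarith
    ultimately have "real_of_int (hi - lo + 1) \<le> 2 * real N * h + 1" by (simp add: algebra_simps)
    then show ?thesis using Nx unfolding n_def by linarith
  qed
  ultimately show ?thesis using that by blast
qed

text \<open>The constants are fixed before \<open>N\<close>, \<open>h\<close>, \<open>Y\<close>,
  \<open>b\<close> and \<open>A\<close>, so that the bound can be applied to each outcome
  separately. The randomness enters only through the last hypothesis on \<open>Y\<close>, that
  nearly noise-free observations occur close to every design point.\<close>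

lemma quasi_mle_error:
  assumes x: "0 \<le> x" "x \<le> 1" and \<beta>: "\<beta> > 0" and L: "L > 0" and f: "f \<in> hoelder_class {0..1} L \<beta>"
  obtains C \<theta> m0 :: real where "C > 0" "\<theta> > 0"
    "\<And>N h Y b A. \<lbrakk>N \<ge> 1; 0 < h; h \<le> 1; m0 \<le> real N * h; A \<ge> 0;
     \<And>k. k \<in> local_indices N x h \<Longrightarrow> f (real_of_int k / real N) \<le> Y k;
     \<And>k. k \<in> local_indices N x h \<Longrightarrow> \<exists>j\<in>local_indices N x h.
        \<bar>real_of_int k - real_of_int j\<bar> \<le> \<theta> * (real N * h) \<and>
        Y j \<le> f (real_of_int j / real N) + A * h powr \<beta>;
     is_quasi_mle \<beta> x h N Y b\<rbrakk> \<Longrightarrow> \<bar>b 0 - f x\<bar> \<le> C * (A + L) * h powr \<beta>"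
proof -
  define d where "d = nat \<lfloor>\<beta> + 1\<rfloor>"
  define l where "l = hoelder_order \<beta>"
  have ld: "l \<le> d" using hoelder_order_bounds[OF \<beta>] unfolding l_def d_def by linarith
  obtain T :: "nat \<Rightarrow> real" where T0: "T 0 = f x" and T:
    "\<And>y. y \<in> {0..1} \<Longrightarrow> \<bar>f y - (\<Sum>i\<le>l. T i * (y - x) ^ i)\<bar> \<le> L * \<bar>y - x\<bar> powr \<beta>"
    using hoelder_class_taylor[OF \<beta> f, of x] L x unfolding l_def by auto
  from poly_bound_one_sided_grid[of d] obtain C \<theta> where C: "C > 0" and \<theta>: "\<theta> > 0" and
    grid: "\<And>p \<alpha> s n u. \<lbrakk>degree p \<le> d; \<And>i. i < n \<Longrightarrow> \<bar>\<alpha> + real i * s\<bar> \<le> 1; s > 0;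
       1/2 \<le> real n * s; d < n; u \<ge> 0; 0 \<le> (\<Sum>i<n. poly p (\<alpha> + real i * s));
       \<And>i. i < n \<Longrightarrow> \<exists>j<n. \<bar>real i - real j\<bar> * s \<le> \<theta> \<and> poly p (\<alpha> + real j * s) \<le> u\<rbrakk>
      \<Longrightarrow> \<bar>coeff p 0\<bar> \<le> C * u"
    by blast
  have main: "\<bar>b 0 - f x\<bar> \<le> (2 * C + 1) * (A + L) * h powr \<beta>"
    if N: "N \<ge> 1" and h: "0 < h" "h \<le> 1" and Nh: "real d + 4 \<le> real N * h" and A: "A \<ge> 0"
      and Y: "\<And>k. k \<in> local_indices N x h \<Longrightarrow> f (real_of_int k / real N) \<le> Y k"
      and good: "\<And>k. k \<in> local_indices N x h \<Longrightarrow> \<exists>j\<in>local_indices N x h.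
        \<bar>real_of_int k - real_of_int j\<bar> \<le> \<theta> * (real N * h) \<and>
        Y j \<le> f (real_of_int j / real N) + A * h powr \<beta>"
      and mle: "is_quasi_mle \<beta> x h N Y b" for N h Y b A
  proof -
    define H where "H = h powr \<beta>"
    have H: "H > 0" using h by (simp add: H_def)
    obtain lo n where loc: "local_indices N x h = (\<lambda>i. lo + int i) ` {..<n}"
      and n: "real N * h - 2 \<le> real n" and "real n \<le> 2 * real N * h + 1"
      by (rule local_indices_interval[OF x N h])
    have N': "real N > 0" using N by simp
    have NH: "real N * h > 0" using N' h by simp
    define y where "y i = real_of_int (lo + int i) / real N" for i
    \<comment> \<open>The substitution \<open>(y - x) / h\<close> maps the window into
      \<open>[-1, 1]\<close>, with grid spacing \<open>s\<close> and first point \<alpha>.\<close>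
    define s where "s = 1 / (real N * h)"
    define \<alpha> where "\<alpha> = (real_of_int lo / real N - x) / h"
    have s: "s > 0" using NH by (simp add: s_def)
    have t: "\<alpha> + real i * s = (y i - x) / h" for i
      using N' h by (simp add: \<alpha>_def s_def y_def field_simps)
    have yx: "\<bar>y i - x\<bar> \<le> h" and y01: "y i \<in> {0..1}" and loci: "lo + int i \<in> local_indices N x h"
      if "i < n" for i
    proof -
      show k: "lo + int i \<in> local_indices N x h" using that by (auto simp: loc)
      then show "\<bar>y i - x\<bar> \<le> h" unfolding y_def local_indices_def by blast
      from k have "1 \<le> real_of_int (lo + int i)" "real_of_int (lo + int i) \<le> real N"
        unfolding local_indices_def by simp_all
      then show "y i \<in> {0..1}" using N' by (auto simp: y_def)
    qed
    define b' where "b' i = (if i \<le> l then T i else 0) - (if i = 0 then L * H else 0)" for i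
    define e where "e i = b i - b' i" for i
    \<comment> \<open>The factors \<open>h ^ i\<close> express the difference of the two polynomials
      in the rescaled variable. The constant coefficient, which carries the estimation error, is not
      changed by them.\<close>
    define p where "p = (\<Sum>i\<le>d. monom (e i * h ^ i) i)"
    have b': "local_poly \<beta> x b' z = (\<Sum>i\<le>l. T i * (z - x) ^ i) - L * H" for z
    proof -
      have "local_poly \<beta> x b' z = (\<Sum>i\<le>d. (if i \<le> l then T i * (z - x) ^ i else 0)
              - (if i = 0 then L * H else 0))"
        unfolding local_poly_eq[OF \<beta>] d_def[symmetric] by (intro sum.cong) (auto simp: b'_def algebra_simps)
      also have "\<dots> = (\<Sum>i\<in>{..d} \<inter> {..l}. T i * (z - x) ^ i) - L * H"
        unfolding sum_subtractf by (subst sum.inter_restrict) (auto intro!: sum.cong)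
      also have "{..d} \<inter> {..l} = {..l}" using ld by auto
      finally show ?thesis .
    qed
    have taylor: "\<bar>f (y i) - (\<Sum>j\<le>l. T j * (y i - x) ^ j)\<bar> \<le> L * H" if "i < n" for i
    proof -
      have "L * \<bar>y i - x\<bar> powr \<beta> \<le> L * H"
        unfolding H_def using L \<beta> yx[OF that] by (intro mult_left_mono powr_mono2) auto
      then show ?thesis using T[OF y01[OF that]] by linarith
    qed
    have feas: "lp_feasible \<beta> x h N Y b'"
      unfolding lp_feasible_def
    proof
      fix k assume k: "k \<in> local_indices N x h"
      then obtain i where i: "i < n" "k = lo + int i" by (auto simp: loc)
      then show "local_poly \<beta> x b' (real_of_int k / real N) \<le> Y k"
        using taylor[OF i(1)] Y[OF k] b'[of "y i"] unfolding y_def i(2) by linarith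
    qed
    have feasb: "local_poly \<beta> x b (real_of_int k / real N) \<le> Y k" if "k \<in> local_indices N x h" for k
      using mle that unfolding is_quasi_mle_def lp_feasible_def by blast
    have obj: "lp_objective \<beta> x h N b' \<le> lp_objective \<beta> x h N b"
      using mle feas unfolding is_quasi_mle_def by blast
    have obj_eq: "lp_objective \<beta> x h N c = (\<Sum>i<n. local_poly \<beta> x c (y i))" for c
      unfolding lp_objective_def loc y_def by (subst sum.reindex) (auto simp: inj_on_def)
    have degp: "degree p \<le> d"
      unfolding p_def by (intro degree_sum_le) (auto intro: order.trans[OF degree_monom_le])
    have pp: "poly p (\<alpha> + real i * s) = local_poly \<beta> x b (y i) - local_poly \<beta> x b' (y i)" for i
    proof -
      have "poly p (\<alpha> + real i * s) = (\<Sum>j\<le>d. e j * (h * (\<alpha> + real i * s)) ^ j)"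
        unfolding p_def poly_sum by (intro sum.cong) (auto simp: poly_monom power_mult_distrib)
      also have "h * (\<alpha> + real i * s) = y i - x" unfolding t using h by simp
      finally show ?thesis
        unfolding local_poly_eq[OF \<beta>] d_def[symmetric] e_def by (simp add: left_diff_distrib sum_subtractf)
    qed
    \<comment> \<open>At a good point the fitted polynomial is at most \<open>Y\<close>, hence at
      most \<open>f + A * H\<close>. The lowered Taylor polynomial is at least
      \<open>f - 2 * L * H\<close>: one \<open>L * H\<close> is the Taylor error, the other the
      lowering.\<close>
    have "\<bar>coeff p 0\<bar> \<le> C * ((A + 2 * L) * H)"
    proof (rule grid[OF degp _ s])
      show "\<bar>\<alpha> + real i * s\<bar> \<le> 1" if "i < n" for i
        using yx[OF that] h unfolding t by simp
      \<comment> \<open>This and \<open>d < n\<close> account for the threshold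
        \<open>d + 4\<close>: since \<open>n\<close> is at least \<open>N * h - 2\<close>, a value
        of \<open>N * h\<close> of at least 4 gives the present claim, and \<open>d + 4\<close>
        leaves \<open>n \<ge> d + 2\<close>.\<close>
      show "1/2 \<le> real n * s" using n Nh NH by (simp add: s_def field_simps)
      show "d < n" using n Nh by linarith
      show "0 \<le> (A + 2 * L) * H" using A L H by simp
      show "0 \<le> (\<Sum>i<n. poly p (\<alpha> + real i * s))"
        using obj unfolding pp obj_eq sum_subtractf by simp
    next
      fix i assume i: "i < n"
      from good[OF loci[OF i]] obtain k where k: "k \<in> local_indices N x h"
        "\<bar>real_of_int (lo + int i) - real_of_int k\<bar> \<le> \<theta> * (real N * h)"
        "Y k \<le> f (real_of_int k / real N) + A * h powr \<beta>" by blast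
      then obtain j where j: "j < n" "k = lo + int j" by (auto simp: loc)
      have "\<bar>real i - real j\<bar> \<le> \<theta> * (real N * h)" using k(2) j(2) by simp
      then have "\<bar>real i - real j\<bar> * s \<le> \<theta>" unfolding s_def using NH by (simp add: field_simps)
      moreover have "poly p (\<alpha> + real j * s) \<le> (A + 2 * L) * H"
        using feasb[OF k(1)] k(3) taylor[OF j(1)] b'[of "y j"]
        unfolding pp j(2) y_def[symmetric] H_def[symmetric] by (simp add: algebra_simps)
      ultimately show "\<exists>j<n. \<bar>real i - real j\<bar> * s \<le> \<theta> \<and> poly p (\<alpha> + real j * s) \<le> (A + 2 * L) * H"
        using j(1) by blast
    qed
    moreover have "coeff p 0 = b 0 - f x + L * H"
      by (simp add: p_def coeff_sum coeff_monom e_def b'_def T0 if_distrib cong: if_cong)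
    moreover have "L * H > 0" using L H by simp
    ultimately have "\<bar>b 0 - f x\<bar> \<le> C * ((A + 2 * L) * H) + L * H" by linarith
    also have "\<dots> \<le> (2 * C + 1) * (A + L) * H"
    proof -
      have "C * (A * H) \<ge> 0" "A * H \<ge> 0" using A H C by simp_all
      then show ?thesis by (simp add: algebra_simps)
    qed
    finally show ?thesis by (simp add: H_def)
  qed
  show ?thesis
  proof (rule that[of "2 * C + 1" \<theta> "real d + 4"])
    show "2 * C + 1 > 0" "\<theta> > 0" using C \<theta> by simp_all
  qed (rule main)
qed

subsection \<open>The autoregressive process and its innovations\<close>

lemma const_extend_range:
  assumes "\<And>u. 0 \<le> u \<Longrightarrow> u \<le> 1 \<Longrightarrow> 0 \<le> f u \<and> f u \<le> \<rho>"
  shows "0 \<le> const_extend f u" "const_extend f u \<le> \<rho>"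
  using assms[of 0] assms[of 1] assms[of u] by (auto simp: const_extend_def)

text \<open>The weights are dominated by \<open>\<rho> ^ i\<close>, so the summability hypothesis
  makes the defining series converge at this outcome for every \<open>k\<close>. Splitting off the
  term of index 0 gives the recursion. The lower bound by the innovation later keeps the denominator
  of the ratio away from 0.\<close>

lemma ar_process_step:
  assumes range: "\<And>u. 0 \<le> u \<Longrightarrow> u \<le> 1 \<Longrightarrow> 0 \<le> f u \<and> f u \<le> \<rho>"
    and summ: "\<And>k. summable (\<lambda>i. \<rho> ^ i * \<bar>eps (k - int i) \<omega>\<bar>)"
  shows "ar_process f eps N k \<omega> =
     const_extend f (real_of_int k / real N) * ar_process f eps N (k - 1) \<omega> + eps k \<omega>"
    and "(\<And>k. eps k \<omega> \<ge> 0) \<Longrightarrow> ar_process f eps N k \<omega> \<ge> eps k \<omega>"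
proof -
  note ce = const_extend_range[OF range]
  define w where "w k i = (\<Prod>l<i. const_extend f (real_of_int (k - int l) / real N))" for k i
  have w0: "0 \<le> w k i" for k i unfolding w_def by (intro prod_nonneg) (use ce in auto)
  have wle: "w k i \<le> \<rho> ^ i" for k i
    using prod_mono[of "{..<i}" "\<lambda>l. const_extend f (real_of_int (k - int l) / real N)" "\<lambda>_. \<rho>"] ce
    unfolding w_def by simp
  have sm: "summable (\<lambda>i. w k i * eps (k - int i) \<omega>)" for k
  proof (rule summable_comparison_test'[OF summ[of k]])
    fix i :: nat
    show "norm (w k i * eps (k - int i) \<omega>) \<le> \<rho> ^ i * \<bar>eps (k - int i) \<omega>\<bar>"
      using mult_right_mono[OF wle[of k i], of "\<bar>eps (k - int i) \<omega>\<bar>"] w0[of k i] by (simp add: abs_mult)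
  qed
  have X: "ar_process f eps N k \<omega> = (\<Sum>i. w k i * eps (k - int i) \<omega>)" for k
    by (simp add: ar_process_def w_def)
  have wS: "w k (Suc i) = const_extend f (real_of_int k / real N) * w (k - 1) i" for k i
    unfolding w_def by (subst prod.lessThan_Suc_shift) (simp add: algebra_simps)
  have "(\<Sum>i. w k (Suc i) * eps (k - int (Suc i)) \<omega>)
      = const_extend f (real_of_int k / real N) * (\<Sum>i. w (k - 1) i * eps (k - 1 - int i) \<omega>)"
    by (subst suminf_mult[OF sm, symmetric]) (simp add: wS mult.assoc algebra_simps)
  then show *: "ar_process f eps N k \<omega> =
     const_extend f (real_of_int k / real N) * ar_process f eps N (k - 1) \<omega> + eps k \<omega>"
    unfolding X using suminf_split_head[OF sm[of k]] by (simp add: w_def)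
  assume pos: "\<And>k. eps k \<omega> \<ge> 0"
  have "ar_process f eps N (k - 1) \<omega> \<ge> 0"
    unfolding X using w0 pos by (intro suminf_nonneg sm) auto
  then show "ar_process f eps N k \<omega> \<ge> eps k \<omega>" unfolding * using ce by simp
qed

section \<open>Almost sure summability and the search for good pairs of innovations\<close>

context prob_space
begin

text \<open>Monotone convergence bounds the expectation of the series by a convergent geometric
  series, so the random series is finite almost surely. Countability of the integers gives one null
  set for all \<open>k\<close>.\<close>

lemma AE_summable_geometric_abs:
  fixes eps :: "int \<Rightarrow> 'a \<Rightarrow> real"
  assumes meas: "\<And>k. eps k \<in> borel_measurable M"
    and bound: "\<And>k. (\<integral>\<^sup>+\<omega>. ennreal \<bar>eps k \<omega>\<bar> \<partial>M) \<le> ennreal B"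
    and \<rho>: "0 \<le> \<rho>" "\<rho> < 1"
  shows "AE \<omega> in M. \<forall>k. summable (\<lambda>i. \<rho> ^ i * \<bar>eps (k - int i) \<omega>\<bar>)"
  unfolding AE_all_countable
proof
  fix k
  have [measurable]: "eps k \<in> borel_measurable M" for k by (rule meas)
  have geo: "summable (\<lambda>i. \<rho> ^ i * \<bar>B\<bar>)" using \<rho> by (intro summable_mult2 summable_geometric) simp
  have "(\<integral>\<^sup>+\<omega>. (\<Sum>i. ennreal (\<rho> ^ i * \<bar>eps (k - int i) \<omega>\<bar>)) \<partial>M)
      = (\<Sum>i. \<integral>\<^sup>+\<omega>. ennreal (\<rho> ^ i * \<bar>eps (k - int i) \<omega>\<bar>) \<partial>M)"
    by (rule nn_integral_suminf) measurable
  also have "\<dots> \<le> (\<Sum>i. ennreal (\<rho> ^ i * \<bar>B\<bar>))"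
  proof (intro suminf_le summableI)
    fix i
    have "(\<integral>\<^sup>+\<omega>. ennreal (\<rho> ^ i * \<bar>eps (k - int i) \<omega>\<bar>) \<partial>M)
        = ennreal (\<rho> ^ i) * (\<integral>\<^sup>+\<omega>. ennreal \<bar>eps (k - int i) \<omega>\<bar> \<partial>M)"
      using \<rho> by (simp add: ennreal_mult nn_integral_cmult)
    also have "\<dots> \<le> ennreal (\<rho> ^ i) * ennreal \<bar>B\<bar>"
      using bound by (intro mult_left_mono order.trans[OF bound] ennreal_leI) auto
    finally show "(\<integral>\<^sup>+\<omega>. ennreal (\<rho> ^ i * \<bar>eps (k - int i) \<omega>\<bar>) \<partial>M) \<le> ennreal (\<rho> ^ i * \<bar>B\<bar>)"
      using \<rho> by (simp add: ennreal_mult)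
  qed
  also have "\<dots> = ennreal (\<Sum>i. \<rho> ^ i * \<bar>B\<bar>)"
    using \<rho> geo by (intro suminf_ennreal2) auto
  finally have "(\<integral>\<^sup>+\<omega>. (\<Sum>i. ennreal (\<rho> ^ i * \<bar>eps (k - int i) \<omega>\<bar>)) \<partial>M) \<noteq> \<infinity>"
    by (auto simp: top_unique)
  then have "AE \<omega> in M. (\<Sum>i. ennreal (\<rho> ^ i * \<bar>eps (k - int i) \<omega>\<bar>)) \<noteq> \<infinity>"
    by (intro nn_integral_PInf_AE) measurable
  then show "AE \<omega> in M. summable (\<lambda>i. \<rho> ^ i * \<bar>eps (k - int i) \<omega>\<bar>)"
  proof (eventually_elim)
    case (elim \<omega>)
    then show ?case using \<rho> by (intro summable_suminf_not_top) auto
  qed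
qed

text \<open>Only the disjoint pairs of consecutive indices are inspected, so that the events are independent.\<close>

lemma prob_no_consecutive_pair:
  fixes eps :: "int \<Rightarrow> 'a \<Rightarrow> real"
  assumes indep: "indep_vars (\<lambda>_. borel) eps UNIV"
    and p1: "\<And>k. p1 \<le> prob {\<omega>\<in>space M. \<kappa> < eps k \<omega>}" "0 \<le> p1"
    and p2: "\<And>k. p2 \<le> prob {\<omega>\<in>space M. eps k \<omega> \<le> y}" "0 \<le> p2"
  shows "prob {\<omega>\<in>space M. \<forall>r<m. \<not> (\<kappa> < eps (s + 2 * int r) \<omega> \<and> eps (s + 2 * int r + 1) \<omega> \<le> y)}
     \<le> (1 - p1 * p2) ^ m"
\<comment> \<open>An intersection over no indices would be the whole type and not
  \<open>space M\<close>, so the empty case is treated apart.\<close>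
proof (cases "m = 0")
  case True
  then show ?thesis by simp
next
  case False
  have [measurable]: "eps k \<in> borel_measurable M" for k using indep by (simp add: indep_vars_def)
  define K where "K r = {s + 2 * int r, s + 2 * int r + 1}" for r :: nat
  define A where "A r = {w \<in> space (PiM (K r) (\<lambda>_. borel :: real measure)).
      \<not> (\<kappa> < w (s + 2 * int r) \<and> w (s + 2 * int r + 1) \<le> y)}" for r
  define E where "E r = {\<omega>\<in>space M. \<kappa> < eps (s + 2 * int r) \<omega> \<and> eps (s + 2 * int r + 1) \<omega> \<le> y}" for r
  have "disjoint_family_on K {..<m}"
    unfolding disjoint_family_on_def K_def by auto
  then have ind: "indep_vars (\<lambda>r. PiM (K r) (\<lambda>_. borel)) (\<lambda>r \<omega>. restrict (\<lambda>i. eps i \<omega>) (K r)) {..<m}"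
    by (intro indep_vars_restrict[OF indep]) auto
  have A: "A r \<in> sets (PiM (K r) (\<lambda>_. borel))" for r
    unfolding A_def K_def by measurable
  have pre: "(\<lambda>\<omega>. restrict (\<lambda>i. eps i \<omega>) (K r)) -` A r \<inter> space M = space M - E r" for r
    by (auto simp: A_def E_def K_def space_PiM)
  have E: "prob (space M - E r) \<le> 1 - p1 * p2" for r
  proof -
    define B where "B i = (if i = s + 2 * int r then {\<kappa><..} else {..y})" for i :: int
    have "E r = (\<Inter>i\<in>K r. eps i -` B i \<inter> space M)"
      by (auto simp: E_def K_def B_def)
    also have "prob \<dots> = (\<Prod>i\<in>K r. prob (eps i -` B i \<inter> space M))"
      by (intro indep_varsD[OF indep]) (auto simp: K_def B_def)
    also have "\<dots> = prob {\<omega>\<in>space M. \<kappa> < eps (s + 2 * int r) \<omega>} *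
        prob {\<omega>\<in>space M. eps (s + 2 * int r + 1) \<omega> \<le> y}"
      by (simp add: K_def B_def vimage_def Int_def conj_commute)
    also have "\<dots> \<ge> p1 * p2" using p1 p2 by (intro mult_mono) auto
    finally have "p1 * p2 \<le> prob (E r)" .
    moreover have "E r \<in> events" unfolding E_def by measurable
    ultimately show ?thesis by (simp add: prob_compl)
  qed
  have "{\<omega>\<in>space M. \<forall>r<m. \<not> (\<kappa> < eps (s + 2 * int r) \<omega> \<and> eps (s + 2 * int r + 1) \<omega> \<le> y)}
     = (\<Inter>r\<in>{..<m}. (\<lambda>\<omega>. restrict (\<lambda>i. eps i \<omega>) (K r)) -` A r \<inter> space M)"
    unfolding pre using False by (auto simp: E_def)
  also have "prob \<dots> = (\<Prod>r<m. prob ((\<lambda>\<omega>. restrict (\<lambda>i. eps i \<omega>) (K r)) -` A r \<inter> space M))"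
    using False A by (intro indep_varsD[OF ind]) auto
  also have "\<dots> \<le> (\<Prod>r<m. 1 - p1 * p2)"
    unfolding pre using E by (intro prod_mono) auto
  finally show ?thesis by simp
qed

text \<open>The indices are cut into \<open>J\<close> blocks of length \<open>m = n div J\<close>,
  each containing \<open>m div 2\<close> disjoint pairs. \<open>B\<close> is the event that some
  block has no successful pair, whence the factor \<open>J\<close> from the union bound. The
  condition \<open>J * J \<le> n\<close> makes the remainder shorter than one block, so off
  \<open>B\<close> every index is within two block lengths of a success.\<close>

lemma spread_consecutive_pairs:
  fixes eps :: "int \<Rightarrow> 'a \<Rightarrow> real" and lo :: int and n J :: nat
  assumes indep: "indep_vars (\<lambda>_. borel) eps UNIV"
    and p1: "\<And>k. p1 \<le> prob {\<omega>\<in>space M. \<kappa> < eps k \<omega>}" "0 \<le> p1"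
    and p2: "\<And>k. p2 \<le> prob {\<omega>\<in>space M. eps k \<omega> \<le> y}" "0 \<le> p2"
    and J: "J \<ge> 1" and n: "J * J \<le> n"
  obtains B where "B \<in> events" "prob B \<le> real J * (1 - p1 * p2) ^ (n div (2 * J))"
    "\<And>\<omega> i. \<omega> \<in> space M - B \<Longrightarrow> i < n \<Longrightarrow>
       \<exists>j<n. real J * \<bar>real i - real j\<bar> \<le> 2 * real n \<and>
         \<kappa> < eps (lo + int j - 1) \<omega> \<and> eps (lo + int j) \<omega> \<le> y"
proof -
  have [measurable]: "eps k \<in> borel_measurable M" for k using indep by (simp add: indep_vars_def)
  define m where "m = n div J"
  have mJ: "J \<le> m" using div_le_mono[OF n, of J] J by (simp add: m_def)
  have Jm: "J * m \<le> n" by (simp add: m_def)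
  have nm: "n < J * m + m"
  proof -
    have "n < J * m + J" using J unfolding m_def
      by (metis Suc_le_eq dividend_less_times_div One_nat_def add.commute mult_Suc_right)
    then show ?thesis using mJ by linarith
  qed
  define G where "G j = {\<omega>\<in>space M. \<forall>r<m div 2.
      \<not> (\<kappa> < eps ((lo + int (j * m)) + 2 * int r) \<omega> \<and> eps ((lo + int (j * m)) + 2 * int r + 1) \<omega> \<le> y)}" for j
  have G: "G j \<in> events" for j unfolding G_def by measurable
  define B where "B = (\<Union>j<J. G j)"
  show ?thesis
  proof
    show "B \<in> events" using G by (auto simp: B_def)
    have "prob B \<le> (\<Sum>j<J. prob (G j))"
      unfolding B_def using G by (intro finite_measure_subadditive_finite) auto
    also have "\<dots> \<le> (\<Sum>j<J. (1 - p1 * p2) ^ (m div 2))"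
      unfolding G_def by (intro sum_mono prob_no_consecutive_pair[OF indep p1 p2])
    finally show "prob B \<le> real J * (1 - p1 * p2) ^ (n div (2 * J))"
      by (simp add: m_def div_mult2_eq mult.commute[of 2 J])
  next
    fix \<omega> i assume \<omega>: "\<omega> \<in> space M - B" and i: "i < n"
    \<comment> \<open>The minimum assigns the leftover indices to the last block.\<close>
    define j where "j = min (i div m) (J - 1)"
    have jJ: "j < J" using J by (auto simp: j_def)
    have "\<omega> \<notin> G j" using \<omega> jJ by (auto simp: B_def)
    then obtain r where r: "r < m div 2"
      "\<kappa> < eps ((lo + int (j * m)) + 2 * int r) \<omega>" "eps ((lo + int (j * m)) + 2 * int r + 1) \<omega> \<le> y"
      using \<omega> by (auto simp: G_def)
    \<comment> \<open>The second member of the pair, hence the \<open>+ 1\<close>. It stays inside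
      the block because \<open>r < m div 2\<close>.\<close>
    define i' where "i' = j * m + 2 * r + 1"
    have i'1: "j * m \<le> i'" "i' < j * m + m" using r(1) by (auto simp: i'_def)
    have jm: "j * m + m \<le> J * m"
      using mult_right_mono[of "Suc j" J m] jJ by (simp add: add.commute)
    have i1: "j * m \<le> i" "i < j * m + 2 * m"
    proof -
      have "j * m \<le> i div m * m" unfolding j_def by (intro mult_right_mono) auto
      then show "j * m \<le> i" using div_times_less_eq_dividend[of i m] by linarith
      show "i < j * m + 2 * m"
      proof (cases "i div m \<le> J - 1")
        case True
        then have "j = i div m" by (simp add: j_def)
        moreover have "i < i div m * m + m"
          using mJ J dividend_less_div_times[of m i] by (simp add: add.commute)
        ultimately show ?thesis by simp
      next
        case False
        then have "j = J - 1" by (simp add: j_def)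
        then have "J * m = j * m + m" using J by (metis Suc_diff_1 add.commute less_le_trans mult_Suc zero_less_one)
        then show ?thesis using i nm by simp
      qed
    qed
    have "\<bar>real i - real i'\<bar> \<le> real (2 * m)" using i1 i'1 by linarith
    then have "real J * \<bar>real i - real i'\<bar> \<le> real J * real (2 * m)" by (intro mult_left_mono) auto
    also have "\<dots> = 2 * real (J * m)" by simp
    also have "\<dots> \<le> 2 * real n" using Jm by (intro mult_left_mono) (auto simp del: of_nat_mult)
    finally show "\<exists>j<n. real J * \<bar>real i - real j\<bar> \<le> 2 * real n \<and>
         \<kappa> < eps (lo + int j - 1) \<omega> \<and> eps (lo + int j) \<omega> \<le> y"
      using r i'1 jm Jm by (intro exI[of _ i']) (auto simp: i'_def algebra_simps)
  qed
qed

end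

subsection \<open>The rate of convergence\<close>

lemma powr_tendsto_0_at_right_0:
  fixes p :: real
  assumes "p > 0"
  shows "((\<lambda>y. y powr p) \<longlongrightarrow> 0) (at_right 0)"
proof -
  have "((\<lambda>y :: real. y powr p) \<longlongrightarrow> 0 powr p) (at_right 0)"
    using assms by (intro tendsto_powr' tendsto_intros) (auto intro: eventually_at_right_less simp: eventually_at_filter)
  then show ?thesis by simp
qed

text \<open>Because \<open>y powr \<delta>\<close> tends to 0, the error term is eventually at most
  half the leading term. The limit serves to show \<open>F 0 = 0\<close> and to choose \<kappa>; the
  lower bound makes small innovations likely enough.\<close>

lemma power_law_near_0:
  fixes F :: "real \<Rightarrow> real"
  assumes pos: "a > 0" "c > 0" "\<delta> > 0"
    and F: "\<exists>g. \<forall>\<^sub>F y in at_right 0. F y = c * y powr a + g y \<and> \<bar>g y\<bar> \<le> c_g * y powr (a + \<delta>)"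
  shows "(F \<longlongrightarrow> 0) (at_right 0)" "\<forall>\<^sub>F y in at_right 0. c / 2 * y powr a \<le> F y"
proof -
  from F obtain g where g: "\<forall>\<^sub>F y in at_right 0. F y = c * y powr a + g y \<and> \<bar>g y\<bar> \<le> c_g * y powr (a + \<delta>)"
    by blast
  note lim = powr_tendsto_0_at_right_0
  show "(F \<longlongrightarrow> 0) (at_right 0)"
  proof (rule Lim_null_comparison)
    show "\<forall>\<^sub>F y in at_right 0. norm (F y) \<le> c * y powr a + c_g * y powr (a + \<delta>)"
      using g
    proof eventually_elim
      case (elim y)
      have "c * y powr a \<ge> 0" using pos by simp
      with elim show ?case by auto
    qed
    show "((\<lambda>y. c * y powr a + c_g * y powr (a + \<delta>)) \<longlongrightarrow> 0) (at_right 0)"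
      using tendsto_add[OF tendsto_mult_left[OF lim[of a]] tendsto_mult_left[OF lim[of "a + \<delta>"]], of c c_g]
        pos by simp
  qed
  have "\<forall>\<^sub>F y in at_right 0. c_g * y powr \<delta> < c / 2"
    using order_tendstoD(2)[OF tendsto_mult_left[OF lim[of \<delta>], of c_g], of "c / 2"] pos by simp
  with g show "\<forall>\<^sub>F y in at_right 0. c / 2 * y powr a \<le> F y"
  proof eventually_elim
    case (elim y)
    have "c_g * y powr (a + \<delta>) = c_g * y powr \<delta> * y powr a" by (simp add: powr_add)
    also have "\<dots> \<le> c / 2 * y powr a" using elim by (intro mult_right_mono) auto
    finally have "- (c / 2 * y powr a) \<le> g y" using elim by linarith
    then show ?case using elim by simp
  qed
qed

text \<open>The third identity is the balance behind this bandwidth: when an innovation falls below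
  \<open>h powr \<beta>\<close> with probability of order \<open>(h powr \<beta>) powr a\<close>, a
  window of order \<open>N * h\<close> points contains on average a bounded but not vanishing number
  of them.\<close>

lemma bandwidth_asymptotics:
  fixes a \<beta> :: real
  assumes "a > 0" "\<beta> > 0"
  defines "h \<equiv> \<lambda>N. real N powr (- 1 / (a * \<beta> + 1))"
  shows "filterlim (\<lambda>N. real N * h N) at_top sequentially" "h \<longlonglongrightarrow> 0"
    "N \<ge> 1 \<Longrightarrow> real N * h N * (h N powr \<beta>) powr a = 1"
    "h N powr \<beta> = real N powr (- \<beta> / (a * \<beta> + 1))"
proof -
  have g: "a * \<beta> + 1 > 0" using assms by (simp add: add_pos_pos)
  have "(\<lambda>N. real N powr (- (a * \<beta> / (a * \<beta> + 1)))) \<longlonglongrightarrow> 0"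
    using assms g by (intro tendsto_neg_powr filterlim_real_sequentially) auto
  then have "filterlim (\<lambda>N. inverse (real N powr (- (a * \<beta> / (a * \<beta> + 1))))) at_top sequentially"
    by (rule filterlim_inverse_at_top) (use eventually_gt_at_top[of 0] in eventually_elim, simp)
  moreover have "\<forall>\<^sub>F N in sequentially. inverse (real N powr (- (a * \<beta> / (a * \<beta> + 1)))) = real N * h N"
    using eventually_ge_at_top[of 1]
  proof eventually_elim
    case (elim N)
    have "inverse (real N powr (- (a * \<beta> / (a * \<beta> + 1)))) = real N powr (a * \<beta> / (a * \<beta> + 1))"
      by (simp add: powr_minus)
    also have "\<dots> = real N powr (1 + - 1 / (a * \<beta> + 1))"
      using g by (intro arg_cong[where f = "\<lambda>e. real N powr e"]) (simp add: field_simps)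
    also have "\<dots> = real N * h N" using elim unfolding h_def by (simp only: powr_add) simp
    finally show ?case .
  qed
  ultimately show "filterlim (\<lambda>N. real N * h N) at_top sequentially"
    using filterlim_cong[OF refl refl] by fast
  show "h \<longlonglongrightarrow> 0"
    unfolding h_def using g by (intro tendsto_neg_powr filterlim_real_sequentially) simp
  show "h N powr \<beta> = real N powr (- \<beta> / (a * \<beta> + 1))"
    by (simp add: h_def powr_powr)
  assume N: "N \<ge> 1"
  have e: "(- 1 / (a * \<beta> + 1)) + (- 1 / (a * \<beta> + 1) * \<beta> * a) = - 1"
    using g by (simp add: field_simps)
  have "real N * h N * (h N powr \<beta>) powr a
      = real N * (real N powr (- 1 / (a * \<beta> + 1)) * real N powr (- 1 / (a * \<beta> + 1) * \<beta> * a))"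
    by (simp add: h_def powr_powr)
  also have "\<dots> = real N * real N powr (- 1)" by (simp only: e flip: powr_add)
  finally show "real N * h N * (h N powr \<beta>) powr a = 1" using N by (simp add: powr_minus)
qed

theorem corollary2p2:
  fixes M :: "'w measure" and eps :: "int \<Rightarrow> 'w \<Rightarrow> real"
    and f F :: "real \<Rightarrow> real"
    and L \<beta> \<rho> a c c_g \<delta> L_eps \<beta>_eps x :: real
    and bhat :: "nat \<Rightarrow> 'w \<Rightarrow> nat \<Rightarrow> real"
  assumes x: "0 \<le> x" "x \<le> 1"
    and params: "L > 0" "\<beta> > 0" "0 < \<rho>" "\<rho> < 1" "a > 0" "c > 0" "c_g > 0" "\<delta> > 0"
      "L_eps > 0" "\<beta>_eps > 0"
    and f_range: "\<And>u. 0 \<le> u \<Longrightarrow> u \<le> 1 \<Longrightarrow> 0 \<le> f u \<and> f u \<le> \<rho>"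
    and f_hoelder: "f \<in> hoelder_class {0..1} L \<beta>"
    and M: "prob_space M"
    and eps_indep: "prob_space.indep_vars M (\<lambda>_. borel) eps UNIV"
    and eps_cdf: "\<And>k. cdf (distr M borel (eps k)) = F"
    and F_zero: "\<exists>g :: real \<Rightarrow> real. \<forall>\<^sub>F y in at_right 0.
      F y = c * y powr a + g y \<and> \<bar>g y\<bar> \<le> c_g * y powr (a + \<delta>)"
    and F_hoelder: "F \<in> hoelder_class {0..} L_eps \<beta>_eps"
    and eps_moment: "integrable M (\<lambda>\<omega>. eps 1 \<omega> powr max 1 (2 * a + \<delta>))"
    and bhat_max: "\<And>N. N \<ge> 1 \<Longrightarrow> AE \<omega> in M.
      is_quasi_mle \<beta> x (real N powr (- 1 / (a * \<beta> + 1))) N (\<lambda>k. ar_ratio f eps N k \<omega>) (bhat N \<omega>)"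
    and bhat_meas: "\<And>N. N \<ge> 1 \<Longrightarrow> (\<lambda>\<omega>. bhat N \<omega> 0) \<in> borel_measurable M"
  shows "bigo_in_prob M (\<lambda>N \<omega>. \<bar>bhat N \<omega> 0 - f x\<bar>) (\<lambda>N. real N powr (- \<beta> / (a * \<beta> + 1)))"
proof -

  \<comment> \<open>Almost sure properties of the innovations\<close>
  interpret prob_space M by (rule M)
  have meas [measurable]: "eps k \<in> borel_measurable M" for k
    using eps_indep by (simp add: indep_vars_def)
  \<comment> \<open>Equal distribution functions give equal laws, which carries the first moment
    from \<open>eps 1\<close> to every \<open>eps k\<close>.\<close>
  have distr_eq: "distr M borel (eps k) = distr M borel (eps 1)" for k
    by (intro cdf_unique real_distribution_distr) (simp_all add: eps_cdf)
  have F: "prob {\<omega>\<in>space M. eps k \<omega> \<le> y} = F y" for k y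
    unfolding eps_cdf[of k, symmetric] cdf_def
    by (subst measure_distr) (auto intro!: arg_cong[where f = prob])
  note F_lim = power_law_near_0(1)[OF params(5,6,8) F_zero]
  note F_lower = power_law_near_0(2)[OF params(5,6,8) F_zero]
  \<comment> \<open>The power law describes \<open>F\<close> only to the right of 0. Monotonicity
    transfers its limit to the point 0, so that the innovations are strictly positive almost
    surely.\<close>
  have F0: "F 0 = 0"
  proof (rule antisym)
    have mono: "F 0 \<le> F y" if "y > 0" for y
      unfolding F[of 1, symmetric] using that by (intro finite_measure_mono) auto
    show "F 0 \<le> 0"
      by (rule tendsto_lowerbound[OF F_lim])
        (auto simp: eventually_at_filter mono intro!: always_eventually)
    show "0 \<le> F 0" unfolding F[of 1, symmetric] by simp
  qed
  have pos: "AE \<omega> in M. \<forall>k. 0 < eps k \<omega>"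
    unfolding AE_all_countable
  proof
    fix k
    have "AE \<omega> in M. \<not> eps k \<omega> \<le> 0"
      using F[of k 0] F0 by (intro AE_I[OF order.refl]) (auto simp: emeasure_eq_measure)
    then show "AE \<omega> in M. 0 < eps k \<omega>" by (simp add: not_le)
  qed
  define B where "B = (\<integral>\<omega>. \<bar>eps 1 \<omega>\<bar> \<partial>M)"
  have int1: "integrable M (eps 1)"
  proof (rule Bochner_Integration.integrable_bound)
    show "integrable M (\<lambda>\<omega>. 1 + eps 1 \<omega> powr max 1 (2 * a + \<delta>))"
      using eps_moment by (intro Bochner_Integration.integrable_add) auto
    show "AE \<omega> in M. norm (eps 1 \<omega>) \<le> norm (1 + eps 1 \<omega> powr max 1 (2 * a + \<delta>))"
      using pos
    proof eventually_elim
      case (elim \<omega>)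
      then have e: "0 < eps 1 \<omega>" by blast
      have "eps 1 \<omega> \<le> 1 + eps 1 \<omega> powr max 1 (2 * a + \<delta>)"
      proof (cases "eps 1 \<omega> \<le> 1")
        case True
        then show ?thesis by (simp add: add_increasing2)
      next
        case False
        then have "eps 1 \<omega> powr 1 \<le> eps 1 \<omega> powr max 1 (2 * a + \<delta>)" by (intro powr_mono) auto
        then show ?thesis using e by simp
      qed
      then show ?case using e by simp
    qed
  qed simp
  have "(\<integral>\<^sup>+\<omega>. ennreal \<bar>eps k \<omega>\<bar> \<partial>M) \<le> ennreal B" for k
  proof -
    have "(\<integral>\<^sup>+\<omega>. ennreal \<bar>eps k \<omega>\<bar> \<partial>M) = (\<integral>\<^sup>+u. ennreal \<bar>u\<bar> \<partial>distr M borel (eps k))"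
      by (subst nn_integral_distr) auto
    also have "\<dots> = (\<integral>\<^sup>+\<omega>. ennreal \<bar>eps 1 \<omega>\<bar> \<partial>M)"
      unfolding distr_eq[of k] by (subst nn_integral_distr) auto
    also have "\<dots> = ennreal B"
      unfolding B_def using int1 by (intro nn_integral_eq_integral) auto
    finally show ?thesis by simp
  qed
  from AE_summable_geometric_abs[OF meas this, of \<rho>] params
  have summ: "AE \<omega> in M. \<forall>k. summable (\<lambda>i. \<rho> ^ i * \<bar>eps (k - int i) \<omega>\<bar>)" by simp
  \<comment> \<open>A level, independent of \<open>N\<close> and of \<eta>, that each innovation
    exceeds with probability at least 1/2. It will bound the denominators from below.\<close>
  obtain \<kappa> where \<kappa>: "\<kappa> > 0" "F \<kappa> < 1/2"
  proof -
    have "\<forall>\<^sub>F y in at_right 0. F y < 1/2" using order_tendstoD(2)[OF F_lim, of "1/2"] by simp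
    then have "\<forall>\<^sub>F y in at_right 0. F y < 1/2 \<and> y > (0::real)"
      by (intro eventually_conj eventually_at_right_less)
    then show ?thesis using that eventually_happens'[of "at_right (0::real)"] by auto
  qed
  have p1: "1/2 \<le> prob {\<omega>\<in>space M. \<kappa> < eps k \<omega>}" for k
  proof -
    have "prob (space M - {\<omega>\<in>space M. eps k \<omega> \<le> \<kappa>}) = 1 - F \<kappa>"
      unfolding F[of k, symmetric] by (intro prob_compl) measurable
    also have "space M - {\<omega>\<in>space M. eps k \<omega> \<le> \<kappa>} = {\<omega>\<in>space M. \<kappa> < eps k \<omega>}" by auto
    finally show ?thesis using \<kappa> by simp
  qed
  obtain C \<theta> m0 :: real where C: "C > 0" and \<theta>: "\<theta> > 0" and
    mle_error: "\<And>N h Y b A. \<lbrakk>N \<ge> 1; 0 < h; h \<le> 1; m0 \<le> real N * h; A \<ge> 0;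
     \<And>k. k \<in> local_indices N x h \<Longrightarrow> f (real_of_int k / real N) \<le> Y k;
     \<And>k. k \<in> local_indices N x h \<Longrightarrow> \<exists>j\<in>local_indices N x h.
        \<bar>real_of_int k - real_of_int j\<bar> \<le> \<theta> * (real N * h) \<and>
        Y j \<le> f (real_of_int j / real N) + A * h powr \<beta>;
     is_quasi_mle \<beta> x h N Y b\<rbrakk> \<Longrightarrow> \<bar>b 0 - f x\<bar> \<le> C * (A + L) * h powr \<beta>"
  proof (rule quasi_mle_error[OF x params(2,1) f_hoelder], goal_cases)
    case (1 C \<theta> m0)
    show ?case by (rule 1(1)[OF 1(2,3)]) (rule 1(4))
  qed

  \<comment> \<open>Choice of the constants and bound on the failure probability\<close>
  define h where "h N = real N powr (- 1 / (a * \<beta> + 1))" for N :: nat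
  note h_asymp = bandwidth_asymptotics[OF params(5,2), folded h_def]
  \<comment> \<open>With \<open>H = N * h N\<close> large, twice the window size is at most
    \<open>6 * H\<close>, so distances of order \<open>2 * n / J\<close> are at most
    \<open>\<theta> * H\<close>.\<close>
  define J where "J = nat \<lceil>6 / \<theta>\<rceil> + 1"
  have J1: "J \<ge> 1" by (simp add: J_def)
  have "6 / \<theta> \<le> real J" unfolding J_def by linarith
  then have J\<theta>: "6 \<le> \<theta> * real J" using \<theta> by (simp add: field_simps)
  show ?thesis
    unfolding bigo_in_prob_def
  proof (intro allI impI)
    fix \<eta> :: real assume \<eta>: "\<eta> > 0"
    \<comment> \<open>The failure probability will be at most \<open>J * exp (- \<Lambda>)\<close>,
      hence at most \<eta>; the maximum with 1 keeps \<Lambda> positive. Each block has at least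
      \<open>H / (8 * J)\<close> pairs, each successful with probability at least
      \<open>c / 4 * z powr a * (h powr \<beta>) powr a\<close>. By the balance identity the product
      of the two is \<open>c * z powr a / (32 * J)\<close>, and \<open>z\<close> is chosen to make
      this \<Lambda>.\<close>
    define \<Lambda> where "\<Lambda> = max 1 (ln (real J / \<eta>))"
    define z where "z = (32 * real J * \<Lambda> / c) powr (1 / a)"
    have \<Lambda>: "\<Lambda> > 0" by (simp add: \<Lambda>_def)
    have z: "z > 0" using \<Lambda> J1 params by (simp add: z_def)
    have za: "z powr a = 32 * real J * \<Lambda> / c" using \<Lambda> J1 params by (simp add: z_def powr_powr)
    \<comment> \<open>At a good pair the noise \<open>eps k / X (k - 1)\<close> is at most
      \<open>y N / \<kappa>\<close>, which is \<open>A * h N powr \<beta>\<close>.\<close>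
    define A where "A = z / \<kappa>"
    have A: "A > 0" using z \<kappa> by (simp add: A_def)
    define y where "y N = z * h N powr \<beta>" for N
    have "filterlim y (at_right 0) sequentially"
    proof (rule tendsto_imp_filterlim_at_right)
      show "y \<longlonglongrightarrow> 0"
      proof -
        have "(\<lambda>N. h N powr \<beta>) \<longlonglongrightarrow> 0"
          using h_asymp(2) params by (intro tendsto_zero_powrI[where b = \<beta>]) (auto simp: h_def)
        from tendsto_mult_left[OF this, of z] show ?thesis by (simp add: y_def[abs_def])
      qed
      show "\<forall>\<^sub>F N in sequentially. y N > 0"
        using eventually_ge_at_top[of 1] by eventually_elim (use z in \<open>auto simp: y_def h_def\<close>)
    qed
    then have "\<forall>\<^sub>F N in sequentially. c / 2 * y N powr a \<le> F (y N)"
      by (rule eventually_compose_filterlim[OF F_lower])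
    \<comment> \<open>Here \<open>m0\<close> is the threshold of the deterministic bound,
      \<open>J * J\<close> makes the blocks long enough, and \<open>8 * J + 8\<close> compensates
      for rounding in the number of pairs per block.\<close>
    moreover define m where "m = max m0 (8 * real J + 8 + real (J * J))"
    have "\<forall>\<^sub>F N in sequentially. m \<le> real N * h N"
      using h_asymp(1) by (simp add: filterlim_at_top)
    moreover have "\<forall>\<^sub>F N in sequentially. h N < 1"
      using order_tendstoD(2)[OF h_asymp(2), of 1] by simp
    ultimately have "\<forall>\<^sub>F N in sequentially. prob {\<omega>\<in>space M.
        \<bar>\<bar>bhat N \<omega> 0 - f x\<bar>\<bar> > C * (A + L) * real N powr (- \<beta> / (a * \<beta> + 1))} \<le> \<eta>"
      using eventually_ge_at_top[of 1]
    proof eventually_elim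
      case (elim N)
      define H where "H = real N * h N"
      have N: "N \<ge> 1" and hN: "0 < h N" "h N \<le> 1" using elim by (auto simp: h_def)
      have H: "m0 \<le> H" "8 * real J + 8 + real (J * J) \<le> H" using elim by (auto simp: m_def H_def)
      have H0: "H > 0" using N hN by (simp add: H_def)
      obtain lo n where loc: "local_indices N x (h N) = (\<lambda>i. lo + int i) ` {..<n}"
        and n: "H - 2 \<le> real n" "real n \<le> 2 * H + 1"
        by (rule local_indices_interval[OF x N hN]) (simp add: H_def)
      have "real (J * J) \<le> real n" using H n by linarith
      then have JJ: "J * J \<le> n" by (simp only: of_nat_le_iff)
      have Fy: "F (y N) \<le> prob {\<omega>\<in>space M. eps k \<omega> \<le> y N}" for k by (simp add: F)
      have Fy0: "0 \<le> F (y N)" "F (y N) \<le> 1" by (simp_all flip: F[of 1])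
      obtain E where E: "E \<in> events" "prob E \<le> real J * (1 - 1/2 * F (y N)) ^ (n div (2 * J))"
        "\<And>\<omega> i. \<omega> \<in> space M - E \<Longrightarrow> i < n \<Longrightarrow>
           \<exists>j<n. real J * \<bar>real i - real j\<bar> \<le> 2 * real n \<and>
             \<kappa> < eps (lo + int j - 1) \<omega> \<and> eps (lo + int j) \<omega> \<le> y N"
        by (rule spread_consecutive_pairs[OF eps_indep p1 _ Fy Fy0(1) J1 JJ, of lo]) simp_all
      \<comment> \<open>The inclusion in \<open>E\<close> can hold only up to a null set:
        positivity, convergence of the series and the maximising property are almost sure
        statements.\<close>
      have "AE \<omega> in M. \<not> \<bar>bhat N \<omega> 0 - f x\<bar> \<le> C * (A + L) * h N powr \<beta> \<longrightarrow> \<omega> \<in> E"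
        using pos summ bhat_max[OF N] AE_space
      proof eventually_elim
        case (elim \<omega>)
        have e0: "0 < eps k \<omega>" for k using elim by blast
        let ?X = "\<lambda>k. ar_process f eps N k \<omega>"
        have Xe: "eps k \<omega> \<le> ?X k" for k
          using elim e0 by (intro ar_process_step(2)[OF f_range]) (auto intro: less_imp_le)
        have X0: "0 < ?X k" for k using Xe[of k] e0[of k] by linarith
        have Y: "ar_ratio f eps N k \<omega> = f (real_of_int k / real N) + eps k \<omega> / ?X (k - 1)"
          if "k \<in> local_indices N x (h N)" for k
        proof -
          have "real_of_int k / real N \<ge> 0" "real_of_int k / real N \<le> 1"
            using that N by (auto simp: local_indices_def)
          then have ce: "const_extend f (real_of_int k / real N) = f (real_of_int k / real N)"
            by (auto simp: const_extend_def)
          have "?X k = f (real_of_int k / real N) * ?X (k - 1) + eps k \<omega>"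
            unfolding ce[symmetric] using elim by (intro ar_process_step(1)[OF f_range]) auto
          then show ?thesis using X0[of "k - 1"] by (simp add: ar_ratio_def field_simps)
        qed
        show ?case
        proof (intro impI, rule ccontr)
          assume *: "\<not> \<bar>bhat N \<omega> 0 - f x\<bar> \<le> C * (A + L) * h N powr \<beta>" and "\<omega> \<notin> E"
          then have \<omega>: "\<omega> \<in> space M - E" using elim by simp
          have "\<bar>bhat N \<omega> 0 - f x\<bar> \<le> C * (A + L) * h N powr \<beta>"
          proof (rule mle_error[OF N hN])
            show "m0 \<le> real N * h N" using H by (simp add: H_def)
            show "A \<ge> 0" using A by simp
            show "is_quasi_mle \<beta> x (h N) N (\<lambda>k. ar_ratio f eps N k \<omega>) (bhat N \<omega>)"
              using elim by (simp add: h_def)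
            show "f (real_of_int k / real N) \<le> ar_ratio f eps N k \<omega>"
              if "k \<in> local_indices N x (h N)" for k
              using Y[OF that] e0[of k] X0[of "k - 1"] by simp
          next
            fix k assume "k \<in> local_indices N x (h N)"
            then obtain i where i: "i < n" "k = lo + int i" by (auto simp: loc)
            from E(3)[OF \<omega> i(1)] obtain j where j: "j < n" "real J * \<bar>real i - real j\<bar> \<le> 2 * real n"
              "\<kappa> < eps (lo + int j - 1) \<omega>" "eps (lo + int j) \<omega> \<le> y N" by blast
            have jloc: "lo + int j \<in> local_indices N x (h N)" using j(1) by (auto simp: loc)
            have "real J * \<bar>real i - real j\<bar> \<le> 6 * H" using j(2) n H by linarith
            also have "\<dots> \<le> \<theta> * real J * H" using J\<theta> H0 by (intro mult_right_mono) auto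
            finally have "real J * \<bar>real i - real j\<bar> \<le> real J * (\<theta> * H)" by (simp add: mult_ac)
            then have "\<bar>real i - real j\<bar> \<le> \<theta> * H" using J1 by simp
            moreover have "eps (lo + int j) \<omega> / ?X (lo + int j - 1) \<le> y N / \<kappa>"
              using j(3,4) Xe[of "lo + int j - 1"] e0[of "lo + int j"] \<kappa> by (intro frac_le) auto
            then have "ar_ratio f eps N (lo + int j) \<omega>
                \<le> f (real_of_int (lo + int j) / real N) + A * h N powr \<beta>"
              unfolding Y[OF jloc] by (simp add: y_def A_def)
            ultimately show "\<exists>j\<in>local_indices N x (h N).
                \<bar>real_of_int k - real_of_int j\<bar> \<le> \<theta> * (real N * h N) \<and>
                ar_ratio f eps N j \<omega> \<le> f (real_of_int j / real N) + A * h N powr \<beta>"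
              using jloc i(2) unfolding H_def by (intro bexI[of _ "lo + int j"]) auto
          qed
          with * show False by blast
        qed
      qed
      then have "prob {\<omega>\<in>space M. \<bar>\<bar>bhat N \<omega> 0 - f x\<bar>\<bar> > C * (A + L) * real N powr (- \<beta> / (a * \<beta> + 1))}
          \<le> prob E"
        using E(1) by (intro finite_measure_mono_AE) (auto simp: h_asymp(4) not_le)
      also have "\<dots> \<le> real J * exp (- \<Lambda>)"
      proof -
        \<comment> \<open>A pair fails with probability at most \<open>1 - q\<close>, which is at
          most \<open>exp (- q)\<close>, and \<open>k\<close> is the number of pairs per
          block.\<close>
        define q where "q = 1/2 * F (y N)"
        define k where "k = n div (2 * J)"
        have "H / (8 * real J) \<le> real k"
        proof -
          have "n < 2 * J * k + 2 * J"
            using J1 unfolding k_def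
            by (metis dividend_less_times_div add.commute mult_pos_pos zero_less_numeral less_le_trans zero_less_one)
          then have "real n < 2 * real J * real k + 2 * real J"
            by (metis of_nat_add of_nat_less_iff of_nat_mult of_nat_numeral)
          moreover have "8 * real J + 8 \<le> H" using H(2) of_nat_0_le_iff[of "J * J"] by linarith
          ultimately have "H \<le> 8 * real J * real k" using n by (simp add: algebra_simps)
          then show ?thesis using J1 by (simp add: field_simps)
        qed
        moreover have "c / 4 * (z powr a * (h N powr \<beta>) powr a) \<le> q"
          using elim z by (simp add: q_def y_def powr_mult)
        ultimately have "H / (8 * real J) * (c / 4 * (z powr a * (h N powr \<beta>) powr a)) \<le> real k * q"
          using params H0 by (intro mult_mono) auto
        moreover have "H / (8 * real J) * (c / 4 * (z powr a * (h N powr \<beta>) powr a))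
            = \<Lambda> * (H * (h N powr \<beta>) powr a)"
          unfolding za using J1 params by (simp add: field_simps)
        ultimately have kq: "\<Lambda> \<le> real k * q" using h_asymp(3)[OF N] by (simp add: H_def)
        have "(1 - q) ^ k \<le> exp (- q) ^ k"
          using exp_ge_add_one_self[of "- q"] Fy0 by (intro power_mono) (auto simp: q_def)
        also have "\<dots> = exp (- (real k * q))" by (simp flip: exp_of_nat_mult)
        also have "\<dots> \<le> exp (- \<Lambda>)" using kq by simp
        finally have "real J * (1 - q) ^ k \<le> real J * exp (- \<Lambda>)" by (intro mult_left_mono) auto
        then show ?thesis using E(2) by (simp add: q_def k_def)
      qed
      also have "\<dots> \<le> real J * exp (- ln (real J / \<eta>))"
        by (intro mult_left_mono) (auto simp: \<Lambda>_def)
      also have "\<dots> = \<eta>" using J1 \<eta> by (simp add: exp_minus)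
      finally show ?case .
    qed
    moreover have "C * (A + L) > 0" using C A params by simp
    ultimately show "\<exists>K>0. \<forall>\<^sub>F N in sequentially. prob {\<omega>\<in>space M.
        \<bar>\<bar>bhat N \<omega> 0 - f x\<bar>\<bar> > K * real N powr (- \<beta> / (a * \<beta> + 1))} \<le> \<eta>"
      by blast
  qed
qed

end
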